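(* For every $t$-tuple of positive odd integers $(m_1,m_2,\dots,m_t)$ there is a graph $G$ such that $p\mapsto\hat\rho(G,p)$ is a piecewise polynomial function on $(0,1)$ with exactly $t$ breakpoints $x_1<x_2<\dots<x_t$ in $(0,1)$, where $x_i$ has order $m_i$.
   Context: Graphs are finite, undirected, simple, with distinguished sender $s$ and receiver $r$. Each edge survives independently with the same probability $p\in(0,1)$. An instruction is a triple $uvw$ with $u,w$ distinct neighbors of $v$; a protocol $A$ is a set of instructions; an $A$-walk is an $s,r$-walk all of whose consecutive triples lie in $A$; $A$ is finite if there are finitely many $A$-walks; $\rho_A(G,p)$ is the probability that all edges of some $A$-walk survive; $\hat\rho(G,p)=\max\{\rho_A(G,p):A$ finite$\}$. For a piecewise polynomial function $f$, a breakpoint of order $m$ is a point $z\in(0,1)$ such that $f$ is $m-1$ times differentiable at $z$ but not $m$ times (being $0$ times differentiable means continuous); equivalently, there are distinct polynomials $q_1,q_2$ and $\varepsilon>0$ with $f=q_1$ on $(z-\varepsilon,z]$, $f=q_2$ on $[z,z+\varepsilon)$, and $q_1-q_2$ has a zero of order $m$ at $z$. *)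

theory Defs
  imports
    "HOL-Probability.Probability"
    "HOL-Computational_Algebra.Polynomial"
begin

text \<open>A finite simple undirected graph with vertex set \<open>V\<close>, edges as two-element subsets of
  \<open>V\<close>, and distinct distinguished vertices \<open>s\<close> (sender) and \<open>r\<close> (receiver).\<close>

definition network :: "'a set \<Rightarrow> 'a set set \<Rightarrow> 'a \<Rightarrow> 'a \<Rightarrow> bool" where
  "network V E s r \<longleftrightarrow>
     finite V \<and> E \<subseteq> {{u, v} | u v. u \<in> V \<and> v \<in> V \<and> u \<noteq> v} \<and> s \<in> V \<and> r \<in> V \<and> s \<noteq> r"

definition instructions :: "'a set set \<Rightarrow> ('a \<times> 'a \<times> 'a) set" where
  "instructions E = {(u, v, w). {u, v} \<in> E \<and> {v, w} \<in> E \<and> u \<noteq> w}"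

text \<open>Walks are nonempty vertex lists; vertices and edges may repeat, including \<open>s\<close> and \<open>r\<close>.\<close>

definition walks :: "'a set \<Rightarrow> 'a set set \<Rightarrow> 'a \<Rightarrow> 'a \<Rightarrow> 'a list set" where
  "walks V E s r =
     {xs. xs \<noteq> [] \<and> set xs \<subseteq> V \<and> hd xs = s \<and> last xs = r \<and>
          successively (\<lambda>u v. {u, v} \<in> E) xs}"

definition walk_edges :: "'a list \<Rightarrow> 'a set set" where
  "walk_edges xs = {{xs ! i, xs ! Suc i} | i. Suc i < length xs}"

definition protocol_walks ::
  "'a set \<Rightarrow> 'a set set \<Rightarrow> 'a \<Rightarrow> 'a \<Rightarrow> ('a \<times> 'a \<times> 'a) set \<Rightarrow> 'a list set" where
  "protocol_walks V E s r A =
     {xs \<in> walks V E s r.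
        \<forall>i. Suc (Suc i) < length xs \<longrightarrow> (xs ! i, xs ! Suc i, xs ! Suc (Suc i)) \<in> A}"

text \<open>A random outcome \<open>\<omega>\<close> tells for each edge whether it survives; the coordinates \<open>\<omega> e\<close>, \<open>e \<in> E\<close>,
  are independent Bernoulli variables with parameter \<open>p\<close>.\<close>

definition rho ::
  "'a set \<Rightarrow> 'a set set \<Rightarrow> 'a \<Rightarrow> 'a \<Rightarrow> ('a \<times> 'a \<times> 'a) set \<Rightarrow> real \<Rightarrow> real" where
  "rho V E s r A p =
     measure_pmf.prob (Pi_pmf E False (\<lambda>_. bernoulli_pmf p))
       {\<omega>. \<exists>xs \<in> protocol_walks V E s r A. \<forall>e \<in> walk_edges xs. \<omega> e}"

text \<open>For a network, the maximum is over a finite set (there are finitely many instructions), which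
  is nonempty because the empty protocol has finitely many walks.\<close>

definition rho_hat :: "'a set \<Rightarrow> 'a set set \<Rightarrow> 'a \<Rightarrow> 'a \<Rightarrow> real \<Rightarrow> real" where
  "rho_hat V E s r p =
     Max {rho V E s r A p | A. A \<subseteq> instructions E \<and> finite (protocol_walks V E s r A)}"

text \<open>The pieces are closed relative to the open interval, so that such a function is continuous
  on it.\<close>

definition piecewise_polynomial_on :: "real \<Rightarrow> real \<Rightarrow> (real \<Rightarrow> real) \<Rightarrow> bool" where
  "piecewise_polynomial_on a b f \<longleftrightarrow>
     (\<exists>(n::nat) (c :: nat \<Rightarrow> real) (q :: nat \<Rightarrow> real poly).
        c 0 = a \<and> c n = b \<and> (\<forall>i<n. c i < c (Suc i)) \<and>
        (\<forall>i<n. \<forall>x \<in> {c i..c (Suc i)} \<inter> {a<..<b}. f x = poly (q i) x))"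

text \<open>For a higher derivative to be taken at \<open>z\<close>, the lower ones have to exist in a neighbourhood
  of \<open>z\<close>.\<close>

fun times_differentiable_at :: "nat \<Rightarrow> (real \<Rightarrow> real) \<Rightarrow> real \<Rightarrow> bool" where
  "times_differentiable_at 0 f z \<longleftrightarrow> isCont f z"
| "times_differentiable_at (Suc 0) f z \<longleftrightarrow> f differentiable (at z)"
| "times_differentiable_at (Suc (Suc k)) f z \<longleftrightarrow>
     (\<forall>\<^sub>F x in nhds z. f differentiable (at x)) \<and> times_differentiable_at (Suc k) (deriv f) z"

definition breakpoint_of_order :: "(real \<Rightarrow> real) \<Rightarrow> nat \<Rightarrow> real \<Rightarrow> bool" where
  "breakpoint_of_order f m z \<longleftrightarrow>
     z \<in> {0<..<1} \<and> m \<ge> 1 \<and>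
     times_differentiable_at (m - 1) f z \<and> \<not> times_differentiable_at m f z"

definition breakpoints :: "(real \<Rightarrow> real) \<Rightarrow> real set" where
  "breakpoints f = {z. \<exists>m. breakpoint_of_order f m z}"

end

(*
  Take a sender s joined to two vertices a and b by two series-parallel networks with reliabilities
  f and g, and add the edges ac, ad, bc, bd, cr, dr. If the only open connection uses all of
  ac, cb, bd in this order, a protocol must contain a walk traversing ac before bd; the symmetric
  outcome requires bd before ac. Splicing two such walks at these arcs produces arbitrarily long
  walks, so a finite protocol must give up one of the two outcomes, of probabilities
  p^4 (1-p)^2 f (1-g) and p^4 (1-p)^2 g (1-f); the same holds for the cycle in the
  other direction. Hence the optimum is the maximum of two polynomials whose difference is
  2 p^4 (1-p)^2 (g - f) and the breakpoints are the odd-order zeros of f - g.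

  Differences of series-parallel reliabilities are closed under multiplication, so it remains to find
  single differences with one simple zero each, at distinct places. For an edge replaced by a path of
  even length this is 2x^2 - x^4 - x = x (1-x) (x^2+x-1) with x a power of p, which vanishes at a root
  of the inverse golden ratio.
*)

theory Submission imports Defs begin

text \<open>A finite protocol is limited only by pairs of outcomes that it cannot serve both. There
  are two such pairs, one for each direction of the 4-cycle, and each pair contains one outcome of
  either weight. Giving up outcomes of different weights costs the mean of the two uniform choices,
  so it never beats the better of these.

  The harder half is to attain the uniform choices: a single finite protocol must serve every other
  connecting outcome. This is done by ranking directed edges and admitting all instructions along
  which the rank grows. Finiteness is then automatic, and only the routes to be given up may fail to
  rise.

  The building block is a path of two edges rather than an edge. Every edge of a subnetwork then
  meets an inner vertex, so parallel composition cannot identify two edges of the simple graph, and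
  the parts stay independent. This is why only even powers of p occur in the subnetworks. Different
  powers move the single zero of the golden-ratio difference to different places, and a product of
  powers of such differences prescribes places and orders separately.\<close>

section \<open>Splicing protocol walks\<close>

text \<open>A protocol constrains only three consecutive vertices, so a common arc is enough
  overlap: every triple of the spliced walk lies entirely in the first or entirely in the second
  walk.\<close>

lemma protocol_walks_splice:
  assumes "P @ [u, v] @ Q \<in> protocol_walks V E s r A"
    and "P' @ [u, v] @ Q' \<in> protocol_walks V E s r A"
  shows "P @ [u, v] @ Q' \<in> protocol_walks V E s r A"
proof -
  let ?x = "P @ [u, v] @ Q" and ?y = "P' @ [u, v] @ Q'" and ?z = "P @ [u, v] @ Q'"
  have "?z \<in> walks V E s r"
    using assms
    by (auto simp: protocol_walks_def walks_def successively_append_iff successively_Cons hd_append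
        split: if_splits)
  moreover have "(?z ! i, ?z ! Suc i, ?z ! Suc (Suc i)) \<in> A" if i: "Suc (Suc i) < length ?z" for i
  proof (cases "i < length P")
    case True
    \<comment> \<open>A triple that starts inside \<open>P\<close> ends at \<open>v\<close> at the
      latest, hence is a triple of the first walk.\<close>
    then have "?z ! j = ?x ! j" if "j \<le> Suc (Suc i)" for j
      using that by (cases "j < length P") (auto simp: nth_append nth_Cons split: nat.splits)
    moreover have "(?x ! i, ?x ! Suc i, ?x ! Suc (Suc i)) \<in> A"
      using assms(1) True unfolding protocol_walks_def by force
    ultimately show ?thesis by simp
  next
    case False
    let ?k = "i - length P + length P'"
    obtain k where k: "i = length P + k" using False by (metis le_iff_add not_le)
    have "?z ! (i + j) = ?y ! (?k + j)" for j
      by (simp add: k nth_append)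
    from this[of 0] this[of 1] this[of 2]
    have "?z ! i = ?y ! ?k" "?z ! Suc i = ?y ! Suc ?k" "?z ! Suc (Suc i) = ?y ! Suc (Suc ?k)"
      by simp_all
    moreover have "(?y ! ?k, ?y ! Suc ?k, ?y ! Suc (Suc ?k)) \<in> A"
      using assms(2) i False unfolding protocol_walks_def by force
    ultimately show ?thesis by simp
  qed
  ultimately show ?thesis by (auto simp: protocol_walks_def)
qed

definition uses_before :: "'a \<times> 'a \<Rightarrow> 'a \<times> 'a \<Rightarrow> 'a list \<Rightarrow> bool" where
  "uses_before e f xs \<longleftrightarrow>
     (\<exists>P M Q. xs = P @ [fst e, snd e] @ M @ [fst f, snd f] @ Q)"

lemma uses_before_both_infinite:
  assumes "xs \<in> protocol_walks V E s r A" "uses_before e f xs"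
    and "ys \<in> protocol_walks V E s r A" "uses_before f e ys"
  shows "infinite (protocol_walks V E s r A)"
proof
  let ?W = "protocol_walks V E s r A"
  assume fin: "finite ?W"
  obtain a b where e: "e = (a, b)" by (cases e)
  obtain c d where f: "f = (c, d)" by (cases f)
  obtain P M Q where xs: "P @ [a, b] @ M @ [c, d] @ Q \<in> ?W"
    using assms(1,2) by (auto simp: uses_before_def e f)
  obtain P' N Q' where ys: "P' @ [c, d] @ N @ [a, b] @ Q' \<in> ?W"
    using assms(3,4) by (auto simp: uses_before_def e f)
  \<comment> \<open>\<open>S\<close> collects the continuations after the arc \<open>e\<close>.
    Prefixing a tour from \<open>e\<close> through \<open>f\<close> back to \<open>e\<close> maps
    \<open>S\<close> into itself and lengthens its members, so a finite \<open>S\<close> could have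
    no longest member.\<close>
  define S where "S = {R. P @ [a, b] @ R \<in> ?W}"
  have "finite S"
  proof (rule finite_imageD)
    show "finite ((\<lambda>R. P @ [a, b] @ R) ` S)"
      by (rule finite_subset[OF _ fin]) (auto simp: S_def)
  qed (auto simp: inj_on_def)
  have step: "(M @ [c, d] @ N @ [a, b]) @ R \<in> S" if "R \<in> S" for R
  proof -
    \<comment> \<open>Splicing at \<open>f\<close> brings the walk back to \<open>e\<close>;
      splicing at \<open>e\<close> then lets it continue with \<open>R\<close>.\<close>
    have "(P @ [a, b] @ M) @ [c, d] @ (N @ [a, b] @ Q') \<in> ?W"
      using protocol_walks_splice[of "P @ [a, b] @ M" c d Q _ _ _ _ _ P'] xs ys by simp
    then have "(P @ [a, b] @ M @ [c, d] @ N) @ [a, b] @ R \<in> ?W"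
      using protocol_walks_splice[of "P @ [a, b] @ M @ [c, d] @ N" a b Q' _ _ _ _ _ P R] that
      by (simp add: S_def)
    then show ?thesis by (simp add: S_def)
  qed
  have ne: "S \<noteq> {}" using xs by (auto simp: S_def)
  obtain R where R: "R \<in> S" "\<And>R'. R' \<in> S \<Longrightarrow> length R' \<le> length R"
  proof -
    have "Max (length ` S) \<in> length ` S"
      using \<open>finite S\<close> ne by (intro Max_in) auto
    then obtain R where "R \<in> S" "length R = Max (length ` S)" by auto
    then show ?thesis using that \<open>finite S\<close> by (simp add: )
  qed
  from R(2)[OF step[OF R(1)]] show False by simp
qed

lemma leaves_set:
  assumes "successively R xs" "xs \<noteq> []" "hd xs \<in> X" "last xs \<notin> X"
  obtains P x y Q where "xs = P @ [x, y] @ Q" "x \<in> X" "y \<notin> X" "R x y"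
proof -
  from assms have "\<exists>P x y Q. xs = P @ [x, y] @ Q \<and> x \<in> X \<and> y \<notin> X \<and> R x y"
  proof (induction xs)
    case (Cons x zs)
    show ?case
    proof (cases zs)
      case Nil
      then show ?thesis using Cons.prems by simp
    next
      case (Cons y ws)
      show ?thesis
      proof (cases "y \<in> X")
        case True
        then obtain P x' y' Q where "zs = P @ [x', y'] @ Q" "x' \<in> X" "y' \<notin> X" "R x' y'"
          using Cons.IH Cons.prems Cons by auto
        then have "x # zs = (x # P) @ [x', y'] @ Q" by simp
        then show ?thesis using \<open>x' \<in> X\<close> \<open>y' \<notin> X\<close> \<open>R x' y'\<close> by blast
      next
        case False
        then have "x # zs = [] @ [x, y] @ ws" "x \<in> X" "R x y"
          using Cons.prems Cons by auto
        with False show ?thesis by blast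
      qed
    qed
  qed simp
  then show ?thesis using that by blast
qed

text \<open>Counting arcs from 0, the rank of the i-th arc of a walk is at least i, while ranks are
  bounded on the finite set \<open>V \<times> V\<close>. This bounds the length of the
  walks.\<close>

lemma finite_protocol_walks_if_ranked:
  fixes \<phi> :: "'a \<times> 'a \<Rightarrow> nat"
  assumes "finite V"
    and A: "\<And>x y z. (x, y, z) \<in> A \<Longrightarrow> \<phi> (x, y) < \<phi> (y, z)"
  shows "finite (protocol_walks V E s r A)"
proof -
  define B where "B = Max (\<phi> ` (V \<times> V))"
  have "length xs \<le> B + 2" if xs: "xs \<in> protocol_walks V E s r A" for xs
  proof (rule ccontr)
    assume "\<not> ?thesis"
    then have len: "length xs > B + 2" by simp
    have V: "xs ! i \<in> V" if "i < length xs" for i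
      using xs that by (auto simp: protocol_walks_def walks_def)
    have "Suc i < length xs \<longrightarrow> i \<le> \<phi> (xs ! i, xs ! Suc i)" for i
    proof (induction i)
      case (Suc i)
      show ?case
      proof
        assume l: "Suc (Suc i) < length xs"
        then have "\<phi> (xs ! i, xs ! Suc i) < \<phi> (xs ! Suc i, xs ! Suc (Suc i))"
          using xs by (intro A) (auto simp: protocol_walks_def)
        then show "Suc i \<le> \<phi> (xs ! Suc i, xs ! Suc (Suc i))" using Suc l by simp
      qed
    qed simp
    from this[of "Suc B"] have "Suc B \<le> \<phi> (xs ! Suc B, xs ! Suc (Suc B))" using len by simp
    also have "\<dots> \<le> B"
      unfolding B_def using V[of "Suc B"] V[of "Suc (Suc B)"] len assms(1)
      by (intro Max_ge finite_imageI finite_cartesian_product imageI) (auto simp: B_def)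
    finally show False by simp
  qed
  then have "protocol_walks V E s r A \<subseteq> {xs. set xs \<subseteq> V \<and> length xs \<le> B + 2}"
    by (auto simp: protocol_walks_def walks_def)
  then show ?thesis
    using finite_lists_length_le[OF assms(1)] finite_subset by blast
qed

section \<open>Independence of edges\<close>

definition edge_prob :: "'a set \<Rightarrow> real \<Rightarrow> (('a \<Rightarrow> bool) \<Rightarrow> bool) \<Rightarrow> real" where
  "edge_prob E p P = measure_pmf.prob (Pi_pmf E False (\<lambda>_. bernoulli_pmf p)) {\<omega>. P \<omega>}"

definition depends_only :: "'a set \<Rightarrow> (('a \<Rightarrow> bool) \<Rightarrow> bool) \<Rightarrow> bool" where
  "depends_only A P \<longleftrightarrow> (\<forall>\<omega> \<omega>'. (\<forall>e\<in>A. \<omega> e = \<omega>' e) \<longrightarrow> P \<omega> = P \<omega>')"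

lemma depends_onlyD: "depends_only A P \<Longrightarrow> (\<And>e. e \<in> A \<Longrightarrow> \<omega> e = \<omega>' e) \<Longrightarrow> P \<omega> = P \<omega>'"
  unfolding depends_only_def by blast

lemma depends_only_edge: "depends_only {e} (\<lambda>\<omega>. \<omega> e)"
  unfolding depends_only_def by simp

lemma depends_only_not: "depends_only A P \<Longrightarrow> depends_only A (\<lambda>\<omega>. \<not> P \<omega>)"
  unfolding depends_only_def by simp

lemma depends_only_conj:
  "depends_only A P \<Longrightarrow> depends_only B Q \<Longrightarrow> depends_only (A \<union> B) (\<lambda>\<omega>. P \<omega> \<and> Q \<omega>)"
  unfolding depends_only_def by (metis UnCI)

lemma depends_only_disj:
  "depends_only A P \<Longrightarrow> depends_only B Q \<Longrightarrow> depends_only (A \<union> B) (\<lambda>\<omega>. P \<omega> \<or> Q \<omega>)"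
  unfolding depends_only_def by (metis UnCI)

lemma edge_prob_not: "edge_prob E p (\<lambda>\<omega>. \<not> P \<omega>) = 1 - edge_prob E p P"
proof -
  have "{\<omega>. \<not> P \<omega>} = space (measure_pmf (Pi_pmf E False (\<lambda>_. bernoulli_pmf p))) - {\<omega>. P \<omega>}" by auto
  then show ?thesis unfolding edge_prob_def by (simp only: measure_pmf.prob_compl sets_measure_pmf UNIV_I)
qed

lemma edge_prob_mono: "(\<And>\<omega>. P \<omega> \<Longrightarrow> Q \<omega>) \<Longrightarrow> edge_prob E p P \<le> edge_prob E p Q"
  unfolding edge_prob_def by (intro measure_pmf.finite_measure_mono) auto

lemma edge_prob_diff:
  assumes "\<And>\<omega>. Q \<omega> \<Longrightarrow> P \<omega>"
  shows "edge_prob E p (\<lambda>\<omega>. P \<omega> \<and> \<not> Q \<omega>) = edge_prob E p P - edge_prob E p Q"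
proof -
  have "{\<omega>. P \<omega> \<and> \<not> Q \<omega>} = {\<omega>. P \<omega>} - {\<omega>. Q \<omega>}" by auto
  then show ?thesis unfolding edge_prob_def
    using assms by (simp add: measure_pmf.finite_measure_Diff Collect_mono_iff)
qed

text \<open>Cutting both sets down to the countable supports puts them within reach of the product
  rule for countable sets.\<close>

lemma prob_pair_pmf_times:
  "measure_pmf.prob (pair_pmf M N) (A \<times> B) = measure_pmf.prob M A * measure_pmf.prob N B"
proof -
  have "measure_pmf.prob (pair_pmf M N) (A \<times> B)
      = measure_pmf.prob (pair_pmf M N) ((A \<inter> set_pmf M) \<times> (B \<inter> set_pmf N))"
    by (rule measure_prob_cong_0) (auto simp: pmf_eq_0_set_pmf)
  also have "\<dots> = measure_pmf.prob M (A \<inter> set_pmf M) * measure_pmf.prob N (B \<inter> set_pmf N)"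
    by (intro measure_pmf_prob_product) auto
  finally show ?thesis by (simp add: measure_Int_set_pmf)
qed

text \<open>The random outcome on \<open>E\<close> is a pair of independent outcomes on
  \<open>A\<close> and \<open>E - A\<close>; \<open>P\<close> reads only the first component, and
  \<open>Q\<close> only the second because \<open>B\<close> lies in \<open>E - A\<close>.\<close>

lemma edge_prob_indep:
  assumes E: "finite E" and AB: "A \<union> B \<subseteq> E" "A \<inter> B = {}"
    and P: "depends_only A P" and Q: "depends_only B Q"
  shows "edge_prob E p (\<lambda>\<omega>. P \<omega> \<and> Q \<omega>) = edge_prob E p P * edge_prob E p Q"
proof -
  let ?M = "\<lambda>A. Pi_pmf A False (\<lambda>_. bernoulli_pmf p)"
  let ?c = "\<lambda>(f, g) x. if x \<in> A then f x else g x"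
  have fin: "finite A" "finite (E - A)" using E AB finite_subset by auto
  have "?M E = ?M (A \<union> (E - A))" using AB by (simp add: Un_absorb1)
  also have "\<dots> = map_pmf ?c (pair_pmf (?M A) (?M (E - A)))"
    using fin by (intro Pi_pmf_union) auto
  finally have M: "?M E = map_pmf ?c (pair_pmf (?M A) (?M (E - A)))" .
  have key: "measure_pmf.prob (?M E) {\<omega>. R \<omega> \<and> S \<omega>} =
      measure_pmf.prob (?M A) {\<omega>. R \<omega>} * measure_pmf.prob (?M (E - A)) {\<omega>. S \<omega>}"
    if "depends_only A R" "depends_only B S" for R S
  proof -
    have "R (?c (f, g)) = R f" for f g using that(1) by (rule depends_onlyD) simp
    moreover have "S (?c (f, g)) = S g" for f g by (rule depends_onlyD[OF that(2)]) (use AB in auto)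
    ultimately have "?c -` {\<omega>. R \<omega> \<and> S \<omega>} = {\<omega>. R \<omega>} \<times> {\<omega>. S \<omega>}"
      by (simp only: set_eq_iff split_paired_All vimage_eq mem_Collect_eq mem_Times_iff fst_conv snd_conv
          simp_thms)
    then show ?thesis
      unfolding M measure_map_pmf using prob_pair_pmf_times by metis
  qed
  \<comment> \<open>With the trivial event on one side, \<open>key\<close> also yields the two
    marginal probabilities.\<close>
  have T: "depends_only C (\<lambda>_. True)" for C :: "'a set" by (simp add: depends_only_def)
  show ?thesis
    unfolding edge_prob_def using key[OF P Q] key[OF P T] key[OF T Q] by simp
qed

lemma edge_prob_edge:
  assumes "finite E" "e \<in> E" "0 \<le> p" "p \<le> 1"
  shows "edge_prob E p (\<lambda>\<omega>. \<omega> e) = p"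
proof -
  have "edge_prob E p (\<lambda>\<omega>. \<omega> e) =
      measure_pmf.prob (map_pmf (\<lambda>\<omega>. \<omega> e) (Pi_pmf E False (\<lambda>_. bernoulli_pmf p))) {True}"
    by (simp add: edge_prob_def vimage_def)
  also have "\<dots> = measure_pmf.prob (bernoulli_pmf p) {True}"
    by (simp only: Pi_pmf_component[OF assms(1)] if_P[OF assms(2)])
  also have "\<dots> = p" using assms by (simp only: measure_pmf_single pmf_bernoulli_True)
  finally show ?thesis .
qed

text \<open>Almost surely the outcome is \<open>False\<close> outside \<open>E\<close>. This leaves
  finitely many outcomes, each weighted by a product of factors p and 1 - p.\<close>

lemma edge_prob_polynomial:
  assumes "finite E"
  obtains q where "\<And>p. 0 \<le> p \<Longrightarrow> p \<le> 1 \<Longrightarrow> edge_prob E p P = poly q p"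
proof
  fix p :: real assume p: "0 \<le> p" "p \<le> 1"
  let ?M = "Pi_pmf E False (\<lambda>_. bernoulli_pmf p)"
  let ?S = "PiE_dflt E False (\<lambda>_. UNIV) \<inter> {\<omega>. P \<omega>}"
  have fin: "finite ?S" using assms by (intro finite_Int disjI1 finite_PiE_dflt) auto
  have "edge_prob E p P = measure_pmf.prob ?M ?S"
    unfolding edge_prob_def
    by (rule measure_prob_cong_0) (use assms in \<open>auto simp: pmf_Pi PiE_dflt_def\<close>)
  also have "\<dots> = (\<Sum>\<omega>\<in>?S. pmf ?M \<omega>)" by (rule measure_measure_pmf_finite[OF fin])
  also have "\<dots> = (\<Sum>\<omega>\<in>?S. \<Prod>e\<in>E. if \<omega> e then p else 1 - p)"
    using assms p by (intro sum.cong) (auto simp: pmf_Pi PiE_dflt_def intro!: prod.cong)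
  also have "\<dots> = poly (\<Sum>\<omega>\<in>?S. \<Prod>e\<in>E. if \<omega> e then [:0, 1:] else [:1, -1:]) p"
    by (simp add: poly_sum poly_prod if_distrib[of "\<lambda>q. poly q p"] cong: if_cong)
  finally show "edge_prob E p P = poly (\<Sum>\<omega>\<in>?S. \<Prod>e\<in>E. if \<omega> e then [:0, 1:] else [:1, -1:]) p" .
qed

section \<open>Series-parallel subnetworks\<close>

text \<open>Paths are required to be increasing in the vertex labels; this keeps them compatible with one
  acyclic orientation, so that a single finite protocol can follow all of them.\<close>

definition subnet ::
  "nat \<Rightarrow> nat \<Rightarrow> nat set \<Rightarrow> nat set set \<Rightarrow> ((nat set \<Rightarrow> bool) \<Rightarrow> bool) \<Rightarrow> bool" where
  "subnet u v I E P \<longleftrightarrow>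
     finite I \<and> finite E \<and>
     (\<forall>e\<in>E. \<exists>x y. e = {x, y} \<and> x \<noteq> y \<and> x \<in> I \<and> y \<in> insert u (insert v I)) \<and>
     depends_only E P \<and>
     (\<forall>\<omega>. P \<omega> \<longrightarrow> (\<exists>xs. xs \<noteq> [] \<and> hd xs = u \<and> last xs = v \<and>
        successively (\<lambda>x y. x < y \<and> {x, y} \<in> E \<and> \<omega> {x, y}) xs)) \<and>
     (\<forall>\<omega>. \<not> P \<omega> \<longrightarrow> (\<exists>X. u \<in> X \<and> v \<notin> X \<and>
        (\<forall>x y. {x, y} \<in> E \<and> \<omega> {x, y} \<longrightarrow> (x \<in> X \<longleftrightarrow> y \<in> X))))"

lemma subnet_edgeE:
  assumes "subnet u v I E P" "e \<in> E"
  obtains x y where "e = {x, y}" "x \<noteq> y" "x \<in> I" "y \<in> insert u (insert v I)"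
proof -
  have "\<forall>e\<in>E. \<exists>x y. e = {x, y} \<and> x \<noteq> y \<and> x \<in> I \<and> y \<in> insert u (insert v I)"
    using assms(1) by (simp add: subnet_def)
  then show ?thesis using assms(2) that by blast
qed

text \<open>In particular no edge joins the two terminals directly, which is what keeps parallel
  parts edge-disjoint.\<close>

lemma subnet_edges:
  assumes "subnet u v I E P" "{x, y} \<in> E"
  shows "x \<noteq> y \<and> {x, y} \<subseteq> insert u (insert v I) \<and> {x, y} \<inter> I \<noteq> {}"
proof -
  obtain x' y' where "{x, y} = {x', y'}" "x' \<noteq> y'" "x' \<in> I" "y' \<in> insert u (insert v I)"
    using subnet_edgeE[OF assms] by metis
  then show ?thesis by (auto simp: doubleton_eq_iff)
qed

lemma subnet_finite: "subnet u v I E P \<Longrightarrow> finite I" "subnet u v I E P \<Longrightarrow> finite E"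
  and subnet_depends: "subnet u v I E P \<Longrightarrow> depends_only E P"
  by (simp_all add: subnet_def)

lemma subnet_path:
  assumes "subnet u v I E P" "P \<omega>"
  obtains xs where "xs \<noteq> []" "hd xs = u" "last xs = v"
    "successively (\<lambda>x y. x < y \<and> {x, y} \<in> E \<and> \<omega> {x, y}) xs"
proof -
  have "\<exists>xs. xs \<noteq> [] \<and> hd xs = u \<and> last xs = v \<and>
      successively (\<lambda>x y. x < y \<and> {x, y} \<in> E \<and> \<omega> {x, y}) xs"
    using assms unfolding subnet_def by (elim conjE allE[of _ \<omega>]) simp
  then show ?thesis using that by blast
qed

text \<open>Failure of \<open>P\<close> is certified by a set that no open edge leaves or enters.
  This set is arbitrary outside the subnetwork, so every composition first intersects it with the
  inner vertices.\<close>

lemma subnet_cut: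
  assumes "subnet u v I E P" "\<not> P \<omega>"
  obtains X where "u \<in> X" "v \<notin> X"
    "\<And>x y. {x, y} \<in> E \<Longrightarrow> \<omega> {x, y} \<Longrightarrow> x \<in> X \<longleftrightarrow> y \<in> X"
proof -
  have "\<exists>X. u \<in> X \<and> v \<notin> X \<and> (\<forall>x y. {x, y} \<in> E \<and> \<omega> {x, y} \<longrightarrow> (x \<in> X \<longleftrightarrow> y \<in> X))"
    using assms unfolding subnet_def by (elim conjE allE[of _ \<omega>]) simp
  then show ?thesis using that by metis
qed

lemma subnet_two_path:
  assumes "u < n" "n < v"
  shows "subnet u v {n} {{u, n}, {n, v}} (\<lambda>\<omega>. \<omega> {u, n} \<and> \<omega> {n, v})"
  unfolding subnet_def
proof (intro conjI allI impI)
  show "depends_only {{u, n}, {n, v}} (\<lambda>\<omega>. \<omega> {u, n} \<and> \<omega> {n, v})"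
    by (simp add: depends_only_def)
  fix \<omega> :: "nat set \<Rightarrow> bool"
  show "\<exists>xs. xs \<noteq> [] \<and> hd xs = u \<and> last xs = v \<and>
        successively (\<lambda>x y. x < y \<and> {x, y} \<in> {{u, n}, {n, v}} \<and> \<omega> {x, y}) xs"
    if "\<omega> {u, n} \<and> \<omega> {n, v}"
    using that assms by (intro exI[of _ "[u, n, v]"]) auto
  show "\<exists>X. u \<in> X \<and> v \<notin> X \<and>
        (\<forall>x y. {x, y} \<in> {{u, n}, {n, v}} \<and> \<omega> {x, y} \<longrightarrow> (x \<in> X \<longleftrightarrow> y \<in> X))"
    if "\<not> (\<omega> {u, n} \<and> \<omega> {n, v})"
  proof -
    have "\<omega> {n, u} = \<omega> {u, n}" "\<omega> {v, n} = \<omega> {n, v}" by (simp_all add: insert_commute)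
    with that assms show ?thesis
      \<comment> \<open>The middle vertex joins the side of \<open>u\<close> if its edge to
        \<open>u\<close> is open; in that case its edge to \<open>v\<close> is closed.\<close>
      by (intro exI[of _ "if \<omega> {u, n} then {u, n} else {u}"]) (auto simp: doubleton_eq_iff)
  qed
next
  have "u \<noteq> n" "n \<noteq> v" "{u, n} = {n, u}" using assms by auto
  then show "\<forall>e\<in>{{u, n}, {n, v}}. \<exists>x y. e = {x, y} \<and> x \<noteq> y \<and> x \<in> {n} \<and> y \<in> {u, v, n}"
    by (metis insert_iff singletonD)
qed simp_all

lemma subnet_series:
  assumes a: "subnet u w I E P" and b: "subnet w v J F Q"
    and "u \<notin> J" "w \<notin> I" "w \<notin> J" "v \<notin> I" "u \<noteq> w" "v \<noteq> w" "u \<noteq> v" "I \<inter> J = {}" "v \<notin> J" "u \<notin> I"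
  shows "subnet u v (insert w (I \<union> J)) (E \<union> F) (\<lambda>\<omega>. P \<omega> \<and> Q \<omega>)"
  unfolding subnet_def
proof (intro conjI allI impI)
  have IJ: "x \<notin> J" if "x \<in> I" for x using that \<open>I \<inter> J = {}\<close> by blast
  show "depends_only (E \<union> F) (\<lambda>\<omega>. P \<omega> \<and> Q \<omega>)"
    using a b by (intro depends_only_conj subnet_depends)
  show "\<forall>e\<in>E \<union> F. \<exists>x y. e = {x, y} \<and> x \<noteq> y \<and> x \<in> insert w (I \<union> J) \<and>
      y \<in> insert u (insert v (insert w (I \<union> J)))"
  proof
    fix e assume "e \<in> E \<union> F"
    then show "\<exists>x y. e = {x, y} \<and> x \<noteq> y \<and> x \<in> insert w (I \<union> J) \<and>
      y \<in> insert u (insert v (insert w (I \<union> J)))"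
    proof
      assume "e \<in> E"
      with a obtain x y where "e = {x, y}" "x \<noteq> y" "x \<in> I" "y \<in> insert u (insert w I)"
        by (rule subnet_edgeE)
      then show ?thesis by (intro exI[of _ x] exI[of _ y]) auto
    next
      assume "e \<in> F"
      with b obtain x y where "e = {x, y}" "x \<noteq> y" "x \<in> J" "y \<in> insert w (insert v J)"
        by (rule subnet_edgeE)
      then show ?thesis by (intro exI[of _ x] exI[of _ y]) auto
    qed
  qed
  fix \<omega> :: "nat set \<Rightarrow> bool"
  let ?R = "\<lambda>E x y. x < y \<and> {x, y} \<in> E \<and> \<omega> {x, y}"
  show "\<exists>xs. xs \<noteq> [] \<and> hd xs = u \<and> last xs = v \<and> successively (?R (E \<union> F)) xs"
    if PQ: "P \<omega> \<and> Q \<omega>"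
  proof -
    obtain xs where xs: "xs \<noteq> []" "hd xs = u" "last xs = w" "successively (?R E) xs"
      using subnet_path[OF a] PQ by blast
    obtain ys where ys: "ys \<noteq> []" "hd ys = w" "last ys = v" "successively (?R F) ys"
      using subnet_path[OF b] PQ by blast
    obtain zs where zs: "ys = w # zs" using ys by (cases ys) auto
    have "zs \<noteq> []" using ys zs assms by auto
    then have "successively (?R F) zs" "?R F w (hd zs)"
      using ys(4) by (auto simp: zs successively_Cons)
    then have "successively (?R (E \<union> F)) (xs @ zs)"
      using xs \<open>zs \<noteq> []\<close>
      by (auto simp: successively_append_iff elim!: successively_mono)
    moreover have "last (xs @ zs) = v" using ys zs \<open>zs \<noteq> []\<close> by auto
    ultimately show ?thesis using xs by (intro exI[of _ "xs @ zs"]) auto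
  qed
  show "\<exists>X. u \<in> X \<and> v \<notin> X \<and>
      (\<forall>x y. {x, y} \<in> E \<union> F \<and> \<omega> {x, y} \<longrightarrow> (x \<in> X \<longleftrightarrow> y \<in> X))"
    if nPQ: "\<not> (P \<omega> \<and> Q \<omega>)"
  proof (cases "P \<omega>")
    case True
    then have "\<not> Q \<omega>" using nPQ by simp
    then obtain X where X: "w \<in> X" "v \<notin> X"
      "\<And>x y. {x, y} \<in> F \<Longrightarrow> \<omega> {x, y} \<Longrightarrow> x \<in> X \<longleftrightarrow> y \<in> X"
      using subnet_cut[OF b] by metis
    \<comment> \<open>The first part goes entirely to the side of \<open>u\<close>; only the failing
      second part is cut.\<close>
    let ?X = "insert u (insert w I) \<union> (X \<inter> J)"
    have "x \<in> ?X \<longleftrightarrow> y \<in> ?X" if "{x, y} \<in> E \<union> F" "\<omega> {x, y}" for x y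
    proof (cases "{x, y} \<in> E")
      case True
      with subnet_edges[OF a True] X(1,2)  IJ assms(3-) show ?thesis by blast
    next
      case False
      with that have F: "{x, y} \<in> F" by simp
      with subnet_edges[OF b F] X(1,2) X(3)[OF F that(2)] IJ assms(3-) show ?thesis by blast
    qed
    then show ?thesis using assms X by (intro exI[of _ ?X]) auto
  next
    case False
    then obtain X where X: "u \<in> X" "w \<notin> X"
      "\<And>x y. {x, y} \<in> E \<Longrightarrow> \<omega> {x, y} \<Longrightarrow> x \<in> X \<longleftrightarrow> y \<in> X"
      using subnet_cut[OF a] by metis
    \<comment> \<open>Here the failing first part is cut, and \<open>w\<close> with the whole second
      part goes to the side of \<open>v\<close>.\<close>
    let ?X = "insert u (X \<inter> I)"
    have "x \<in> ?X \<longleftrightarrow> y \<in> ?X" if "{x, y} \<in> E \<union> F" "\<omega> {x, y}" for x y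
    proof (cases "{x, y} \<in> E")
      case True
      with subnet_edges[OF a True] X(1,2) X(3)[OF True that(2)] IJ assms(3-) show ?thesis by blast
    next
      case False
      with that have F: "{x, y} \<in> F" by simp
      with subnet_edges[OF b F] X(1,2)  IJ assms(3-) show ?thesis by blast
    qed
    then show ?thesis using assms X by (intro exI[of _ ?X]) auto
  qed
qed (use subnet_finite[OF a] subnet_finite[OF b] in simp_all)

lemma subnet_parallel:
  assumes a: "subnet u v I E P" and b: "subnet u v J F Q"
    and "u \<notin> J" "u \<notin> I" "v \<notin> J" "v \<notin> I" "u \<noteq> v" "I \<inter> J = {}"
  shows "subnet u v (I \<union> J) (E \<union> F) (\<lambda>\<omega>. P \<omega> \<or> Q \<omega>)"
  unfolding subnet_def
proof (intro conjI allI impI)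
  have IJ: "x \<notin> J" if "x \<in> I" for x using that \<open>I \<inter> J = {}\<close> by blast
  show "depends_only (E \<union> F) (\<lambda>\<omega>. P \<omega> \<or> Q \<omega>)"
    using a b by (intro depends_only_disj subnet_depends)
  show "\<forall>e\<in>E \<union> F. \<exists>x y. e = {x, y} \<and> x \<noteq> y \<and> x \<in> I \<union> J \<and> y \<in> insert u (insert v (I \<union> J))"
  proof
    fix e assume "e \<in> E \<union> F"
    then show "\<exists>x y. e = {x, y} \<and> x \<noteq> y \<and> x \<in> I \<union> J \<and> y \<in> insert u (insert v (I \<union> J))"
    proof
      assume "e \<in> E"
      with a obtain x y where "e = {x, y}" "x \<noteq> y" "x \<in> I" "y \<in> insert u (insert v I)"
        by (rule subnet_edgeE)
      then show ?thesis by (intro exI[of _ x] exI[of _ y]) auto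
    next
      assume "e \<in> F"
      with b obtain x y where "e = {x, y}" "x \<noteq> y" "x \<in> J" "y \<in> insert u (insert v J)"
        by (rule subnet_edgeE)
      then show ?thesis by (intro exI[of _ x] exI[of _ y]) auto
    qed
  qed
  fix \<omega> :: "nat set \<Rightarrow> bool"
  let ?R = "\<lambda>E x y. x < y \<and> {x, y} \<in> E \<and> \<omega> {x, y}"
  show "\<exists>xs. xs \<noteq> [] \<and> hd xs = u \<and> last xs = v \<and> successively (?R (E \<union> F)) xs"
    if PQ: "P \<omega> \<or> Q \<omega>"
  proof -
    obtain xs where xs: "xs \<noteq> []" "hd xs = u" "last xs = v"
      "successively (?R E) xs \<or> successively (?R F) xs"
      using PQ by (auto elim!: subnet_path[OF a] subnet_path[OF b])
    then have "successively (?R (E \<union> F)) xs" by (auto elim!: successively_mono)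
    then show ?thesis using xs by blast
  qed
  show "\<exists>X. u \<in> X \<and> v \<notin> X \<and>
      (\<forall>x y. {x, y} \<in> E \<union> F \<and> \<omega> {x, y} \<longrightarrow> (x \<in> X \<longleftrightarrow> y \<in> X))"
    if nPQ: "\<not> (P \<omega> \<or> Q \<omega>)"
  proof -
    obtain X where X: "u \<in> X" "v \<notin> X"
      "\<And>x y. {x, y} \<in> E \<Longrightarrow> \<omega> {x, y} \<Longrightarrow> x \<in> X \<longleftrightarrow> y \<in> X"
      using subnet_cut[OF a] nPQ by metis
    obtain Y where Y: "u \<in> Y" "v \<notin> Y"
      "\<And>x y. {x, y} \<in> F \<Longrightarrow> \<omega> {x, y} \<Longrightarrow> x \<in> Y \<longleftrightarrow> y \<in> Y"
      using subnet_cut[OF b] nPQ by metis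
    let ?X = "insert u ((X \<inter> I) \<union> (Y \<inter> J))"
    have "x \<in> ?X \<longleftrightarrow> y \<in> ?X" if "{x, y} \<in> E \<union> F" "\<omega> {x, y}" for x y
    proof (cases "{x, y} \<in> E")
      case True
      with subnet_edges[OF a True] X(1,2) X(3)[OF True that(2)] IJ assms(3-) show ?thesis by blast
    next
      case False
      with that have F: "{x, y} \<in> F" by simp
      with subnet_edges[OF b F] X(1,2) Y(1,2) Y(3)[OF F that(2)] IJ assms(3-) show ?thesis by blast
    qed
    then show ?thesis using assms X by (intro exI[of _ ?X]) auto
  qed
qed (use subnet_finite[OF a] subnet_finite[OF b] in simp_all)

text \<open>An edge of the first part has an end in \<open>I\<close>, which is neither inner nor a
  terminal in the second part.\<close>

lemma subnet_disjoint_edges: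
  assumes "subnet u v I E P" "subnet u' v' J F Q" "u' \<notin> I" "v' \<notin> I" "I \<inter> J = {}"
  shows "E \<inter> F = {}"
proof -
  have False if "e \<in> E" "e \<in> F" for e
  proof -
    obtain x y where xy: "e = {x, y}" "x \<in> I" using subnet_edgeE[OF assms(1) \<open>e \<in> E\<close>] by metis
    obtain x' y' where "e = {x', y'}" "x' \<in> J" "y' \<in> insert u' (insert v' J)"
      using subnet_edgeE[OF assms(2) \<open>e \<in> F\<close>] by metis
    then show False using xy assms(3-) by (auto simp: doubleton_eq_iff)
  qed
  then show ?thesis by blast
qed

text \<open>One block length \<open>k\<close> serves all placements. The inner labels lie strictly
  between \<open>u\<close> and \<open>v\<close>, so that parts can be chained with increasing paths.
  Quantifying over \<open>E'\<close> makes the reliability independent of the network in which the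
  part is embedded.\<close>

definition realizable :: "real poly \<Rightarrow> bool" where
  "realizable q \<longleftrightarrow> (\<exists>k. \<forall>u v n. u < n \<and> n + k \<le> v \<longrightarrow>
     (\<exists>E P. subnet u v {n..<n + k} E P \<and>
        (\<forall>E' p. finite E' \<and> E \<subseteq> E' \<and> 0 < p \<and> p < 1 \<longrightarrow> edge_prob E' p P = poly q p)))"

text \<open>The base case has two edges, since an edge of a subnetwork must meet an inner
  vertex.\<close>

lemma realizable_square: "realizable (monom 1 2)"
  unfolding realizable_def
proof (intro exI[of _ "1::nat"] allI impI)
  fix u v n :: nat assume *: "u < n \<and> n + 1 \<le> v"
  show "\<exists>E P. subnet u v {n..<n + 1} E P \<and>
        (\<forall>E' p. finite E' \<and> E \<subseteq> E' \<and> 0 < p \<and> p < 1 \<longrightarrow> edge_prob E' p P = poly (monom 1 2) p)"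
  proof (intro exI conjI allI impI)
    show "subnet u v {n..<n + 1} {{u, n}, {n, v}} (\<lambda>\<omega>. \<omega> {u, n} \<and> \<omega> {n, v})"
      using * subnet_two_path[of u n v] by simp
    fix E' and p :: real
    assume **: "finite E' \<and> {{u, n}, {n, v}} \<subseteq> E' \<and> 0 < p \<and> p < 1"
    have "edge_prob E' p (\<lambda>\<omega>. \<omega> {u, n} \<and> \<omega> {n, v}) =
      edge_prob E' p (\<lambda>\<omega>. \<omega> {u, n}) * edge_prob E' p (\<lambda>\<omega>. \<omega> {n, v})"
      using * ** by (intro edge_prob_indep[OF _ _ _ depends_only_edge depends_only_edge])
        (auto simp: doubleton_eq_iff)
    then show "edge_prob E' p (\<lambda>\<omega>. \<omega> {u, n} \<and> \<omega> {n, v}) = poly (monom 1 2) p"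
      using ** by (simp add: edge_prob_edge poly_monom power2_eq_square)
  qed
qed

lemma realizable_series:
  assumes "realizable q" "realizable q'"
  shows "realizable (q * q')"
proof -
  obtain k where k: "\<And>u v n. u < n \<and> n + k \<le> v \<Longrightarrow>
     (\<exists>E P. subnet u v {n..<n + k} E P \<and>
        (\<forall>E' p. finite E' \<and> E \<subseteq> E' \<and> 0 < p \<and> p < 1 \<longrightarrow> edge_prob E' p P = poly q p))"
    using assms(1) unfolding realizable_def by blast
  obtain l where l: "\<And>u v n. u < n \<and> n + l \<le> v \<Longrightarrow>
     (\<exists>E P. subnet u v {n..<n + l} E P \<and>
        (\<forall>E' p. finite E' \<and> E \<subseteq> E' \<and> 0 < p \<and> p < 1 \<longrightarrow> edge_prob E' p P = poly q' p))"
    using assms(2) unfolding realizable_def by blast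
  show ?thesis unfolding realizable_def
  \<comment> \<open>The extra label is the middle terminal \<open>n + k\<close>, placed between the
    two blocks to keep paths increasing.\<close>
  proof (intro exI[of _ "Suc (k + l)"] allI impI)
    fix u v n :: nat assume *: "u < n \<and> n + Suc (k + l) \<le> v"
    obtain E P where a: "subnet u (n + k) {n..<n + k} E P"
      "\<And>E' p. finite E' \<and> E \<subseteq> E' \<and> 0 < p \<and> p < 1 \<Longrightarrow> edge_prob E' p P = poly q p"
      using k[of u n "n + k"] * by auto
    obtain F Q where b: "subnet (n + k) v {Suc (n + k)..<Suc (n + k) + l} F Q"
      "\<And>E' p. finite E' \<and> F \<subseteq> E' \<and> 0 < p \<and> p < 1 \<Longrightarrow> edge_prob E' p Q = poly q' p"
      using l[of "n + k" "Suc (n + k)" v] * by auto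
    have I: "{n..<n + Suc (k + l)} = insert (n + k) ({n..<n + k} \<union> {Suc (n + k)..<Suc (n + k) + l})"
      by auto
    have disj: "E \<inter> F = {}"
      using * by (intro subnet_disjoint_edges[OF a(1) b(1)]) auto
    show "\<exists>E P. subnet u v {n..<n + Suc (k + l)} E P \<and>
        (\<forall>E' p. finite E' \<and> E \<subseteq> E' \<and> 0 < p \<and> p < 1 \<longrightarrow> edge_prob E' p P = poly (q * q') p)"
    proof (intro exI conjI allI impI)
      show "subnet u v {n..<n + Suc (k + l)} (E \<union> F) (\<lambda>\<omega>. P \<omega> \<and> Q \<omega>)"
        unfolding I using * by (intro subnet_series[OF a(1) b(1)]) auto
      fix E' and p :: real assume **: "finite E' \<and> E \<union> F \<subseteq> E' \<and> 0 < p \<and> p < 1"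
      then have "edge_prob E' p (\<lambda>\<omega>. P \<omega> \<and> Q \<omega>) = edge_prob E' p P * edge_prob E' p Q"
        using disj a(1) b(1) by (intro edge_prob_indep[of _ E F] subnet_depends) auto
      then show "edge_prob E' p (\<lambda>\<omega>. P \<omega> \<and> Q \<omega>) = poly (q * q') p"
        using ** a(2) b(2) by simp
    qed
  qed
qed

lemma realizable_parallel:
  assumes "realizable q" "realizable q'"
  shows "realizable (q + q' - q * q')"
proof -
  obtain k where k: "\<And>u v n. u < n \<and> n + k \<le> v \<Longrightarrow>
     (\<exists>E P. subnet u v {n..<n + k} E P \<and>
        (\<forall>E' p. finite E' \<and> E \<subseteq> E' \<and> 0 < p \<and> p < 1 \<longrightarrow> edge_prob E' p P = poly q p))"
    using assms(1) unfolding realizable_def by blast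
  obtain l where l: "\<And>u v n. u < n \<and> n + l \<le> v \<Longrightarrow>
     (\<exists>E P. subnet u v {n..<n + l} E P \<and>
        (\<forall>E' p. finite E' \<and> E \<subseteq> E' \<and> 0 < p \<and> p < 1 \<longrightarrow> edge_prob E' p P = poly q' p))"
    using assms(2) unfolding realizable_def by blast
  show ?thesis unfolding realizable_def
  proof (intro exI[of _ "k + l"] allI impI)
    fix u v n :: nat assume *: "u < n \<and> n + (k + l) \<le> v"
    obtain E P where a: "subnet u v {n..<n + k} E P"
      "\<And>E' p. finite E' \<and> E \<subseteq> E' \<and> 0 < p \<and> p < 1 \<Longrightarrow> edge_prob E' p P = poly q p"
      using k[of u n v] * by auto
    obtain F Q where b: "subnet u v {n + k..<n + k + l} F Q"
      "\<And>E' p. finite E' \<and> F \<subseteq> E' \<and> 0 < p \<and> p < 1 \<Longrightarrow> edge_prob E' p Q = poly q' p"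
      using l[of u "n + k" v] * by auto
    have I: "{n..<n + (k + l)} = {n..<n + k} \<union> {n + k..<n + k + l}"
      by auto
    have disj: "E \<inter> F = {}"
      using * by (intro subnet_disjoint_edges[OF a(1) b(1)]) auto
    show "\<exists>E P. subnet u v {n..<n + (k + l)} E P \<and>
        (\<forall>E' p. finite E' \<and> E \<subseteq> E' \<and> 0 < p \<and> p < 1 \<longrightarrow> edge_prob E' p P = poly (q + q' - q * q') p)"
    proof (intro exI conjI allI impI)
      show "subnet u v {n..<n + (k + l)} (E \<union> F) (\<lambda>\<omega>. P \<omega> \<or> Q \<omega>)"
        unfolding I using * by (intro subnet_parallel[OF a(1) b(1)]) auto
      fix E' and p :: real assume **: "finite E' \<and> E \<union> F \<subseteq> E' \<and> 0 < p \<and> p < 1"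
      have "edge_prob E' p (\<lambda>\<omega>. P \<omega> \<or> Q \<omega>) = 1 - edge_prob E' p (\<lambda>\<omega>. \<not> P \<omega> \<and> \<not> Q \<omega>)"
        using edge_prob_not[of E' p "\<lambda>\<omega>. \<not> P \<omega> \<and> \<not> Q \<omega>"] by simp
      also have "edge_prob E' p (\<lambda>\<omega>. \<not> P \<omega> \<and> \<not> Q \<omega>) =
          edge_prob E' p (\<lambda>\<omega>. \<not> P \<omega>) * edge_prob E' p (\<lambda>\<omega>. \<not> Q \<omega>)"
        using ** disj a(1) b(1)
        by (intro edge_prob_indep[of _ E F] depends_only_not subnet_depends) auto
      finally show "edge_prob E' p (\<lambda>\<omega>. P \<omega> \<or> Q \<omega>) = poly (q + q' - q * q') p"
        using ** a(2)[of E' p] b(2)[of E' p] by (simp add: edge_prob_not algebra_simps)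
    qed
  qed
qed

lemma realizable_power: "realizable q \<Longrightarrow> realizable (q ^ Suc j)"
  by (induction j) (auto intro: realizable_series)

section \<open>The gadget\<close>

text \<open>The condition \<open>x \<noteq> z\<close> mirrors the requirement that the outer
  vertices of an instruction are distinct.\<close>

fun rising :: "('a \<times> 'a \<Rightarrow> nat) \<Rightarrow> 'a list \<Rightarrow> bool" where
  "rising \<phi> (x # y # z # zs) \<longleftrightarrow> x \<noteq> z \<and> \<phi> (x, y) < \<phi> (y, z) \<and> rising \<phi> (y # z # zs)"
| "rising \<phi> _ \<longleftrightarrow> True"

lemma rising_nth:
  "rising \<phi> xs \<Longrightarrow> Suc (Suc i) < length xs \<Longrightarrow>
     xs ! i \<noteq> xs ! Suc (Suc i) \<and> \<phi> (xs ! i, xs ! Suc i) < \<phi> (xs ! Suc i, xs ! Suc (Suc i))"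
proof (induction \<phi> xs arbitrary: i rule: rising.induct)
  case (1 \<phi> x y z zs)
  then show ?case by (cases i) auto
qed auto

text \<open>Arcs of \<open>xs\<close> are ranked by the label of their head, so an increasing path
  rises by itself and its last arc has rank \<open>last xs\<close>. The tail must start above that
  rank, and avoiding \<open>t\<close> excludes turning back at the joint.\<close>

lemma rising_append:
  fixes xs :: "nat list"
  assumes "xs \<noteq> []" "successively (\<lambda>x y. x < y \<and> \<phi> (x, y) = y \<and> x \<noteq> t) xs"
    and "rising \<phi> (last xs # t # ts)" "last xs < \<phi> (last xs, t)"
  shows "rising \<phi> (xs @ t # ts)"
  using assms
proof (induction xs)
  case (Cons x xs)
  then show ?case
  proof (cases xs)
    case (Cons y ys)
    then have "rising \<phi> (y # ys @ t # ts)" "x < y" "\<phi> (x, y) = y" "x \<noteq> t"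
      using Cons.IH Cons.prems by auto
    moreover have "y < \<phi> (y, hd (ys @ [t])) \<and> (ys \<noteq> [] \<longrightarrow> y < hd ys)"
      using Cons Cons.prems by (cases ys) auto
    ultimately show ?thesis
      using Cons by (cases ys) auto
  qed simp
qed simp

definition survives :: "'a set \<Rightarrow> 'a set set \<Rightarrow> 'a \<Rightarrow> 'a \<Rightarrow> ('a \<times> 'a \<times> 'a) set \<Rightarrow> ('a set \<Rightarrow> bool) \<Rightarrow> bool" where
  "survives V E s r A \<omega> \<longleftrightarrow> (\<exists>xs \<in> protocol_walks V E s r A. \<forall>e \<in> walk_edges xs. \<omega> e)"

lemma rho_eq_edge_prob: "rho V E s r A p = edge_prob E p (survives V E s r A)"
  by (simp add: rho_def edge_prob_def survives_def)

lemma successively_alive: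
  assumes "xs \<in> walks V E s r" "\<forall>e \<in> walk_edges xs. \<omega> e"
  shows "successively (\<lambda>x y. {x, y} \<in> E \<and> \<omega> {x, y}) xs"
  using assms by (auto simp: walks_def walk_edges_def successively_conv_nth)

lemma survivesI:
  assumes "xs \<noteq> []" "hd xs = s" "last xs = r" "set xs \<subseteq> V"
    and "successively (\<lambda>x y. {x, y} \<in> E \<and> \<omega> {x, y}) xs"
    and "\<And>i. Suc (Suc i) < length xs \<Longrightarrow> (xs ! i, xs ! Suc i, xs ! Suc (Suc i)) \<in> A"
  shows "survives V E s r A \<omega>"
proof -
  have "successively (\<lambda>x y. {x, y} \<in> E) xs"
    using assms(5) by (rule successively_mono) auto
  moreover have "\<forall>e \<in> walk_edges xs. \<omega> e"
    using assms(5) by (auto simp: walk_edges_def successively_conv_nth)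
  ultimately show ?thesis
    using assms by (auto simp: survives_def protocol_walks_def walks_def)
qed

text \<open>Peels one edge off a nested conjunction; the two claims on \<open>depends_only\<close>
  make the step repeatable.\<close>

lemma edge_prob_edge_conj:
  assumes "finite E" "e \<in> E" "B \<subseteq> E" "e \<notin> B" "depends_only B Q" "0 < p" "p < 1"
  shows "edge_prob E p (\<lambda>\<omega>. \<omega> e \<and> Q \<omega>) = p * edge_prob E p Q"
    and "edge_prob E p (\<lambda>\<omega>. \<not> \<omega> e \<and> Q \<omega>) = (1 - p) * edge_prob E p Q"
    and "depends_only (insert e B) (\<lambda>\<omega>. \<omega> e \<and> Q \<omega>)"
    and "depends_only (insert e B) (\<lambda>\<omega>. \<not> \<omega> e \<and> Q \<omega>)"
proof -
  have *: "{e} \<union> B \<subseteq> E" "{e} \<inter> B = {}" using assms by auto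
  show "edge_prob E p (\<lambda>\<omega>. \<omega> e \<and> Q \<omega>) = p * edge_prob E p Q"
    using edge_prob_indep[OF assms(1) * depends_only_edge assms(5)] assms
    by (simp add: edge_prob_edge)
  show "edge_prob E p (\<lambda>\<omega>. \<not> \<omega> e \<and> Q \<omega>) = (1 - p) * edge_prob E p Q"
    using edge_prob_indep[OF assms(1) * depends_only_not[OF depends_only_edge] assms(5)] assms
    by (simp add: edge_prob_edge edge_prob_not)
  show "depends_only (insert e B) (\<lambda>\<omega>. \<omega> e \<and> Q \<omega>)"
    using depends_only_conj[OF depends_only_edge assms(5), of e] by simp
  show "depends_only (insert e B) (\<lambda>\<omega>. \<not> \<omega> e \<and> Q \<omega>)"
    using depends_only_conj[OF depends_only_not[OF depends_only_edge] assms(5), of e] by simp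
qed

text \<open>The outcomes in which the only open route is \<open>s \<dots> a, c, b, d, r\<close>; exchanging \<open>c, d\<close> or
  \<open>(a, f), (b, h)\<close> gives the three other routes of this kind.\<close>

definition lost where
  "lost a b c d r f h \<omega> \<longleftrightarrow>
     \<omega> {a, c} \<and> \<omega> {b, c} \<and> \<omega> {b, d} \<and> \<omega> {d, r} \<and> \<not> \<omega> {a, d} \<and> \<not> \<omega> {c, r} \<and> f \<omega> \<and> \<not> h \<omega>"

text \<open>Describes when \<open>a\<close> is reached from \<open>s\<close>: through its own
  subnetwork, or from \<open>b\<close> by a detour over \<open>c\<close> or \<open>d\<close>. Routes
  through \<open>r\<close> are left out, as reaching \<open>r\<close> is already the goal.\<close>

definition linked where
  "linked a b c d f h \<omega> \<longleftrightarrow> f \<omega> \<or> h \<omega> \<and> (\<omega> {b, c} \<and> \<omega> {a, c} \<or> \<omega> {b, d} \<and> \<omega> {a, d})"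

definition terminals_linked where
  "terminals_linked a b c d r f h \<omega> \<longleftrightarrow>
     (linked a b c d f h \<omega> \<and> \<omega> {a, c} \<or> linked b a c d h f \<omega> \<and> \<omega> {b, c}) \<and> \<omega> {c, r} \<or>
     (linked a b c d f h \<omega> \<and> \<omega> {a, d} \<or> linked b a c d h f \<omega> \<and> \<omega> {b, d}) \<and> \<omega> {d, r}"

section \<open>Cuts and connectivity of the gadget\<close>

locale gadget =
  fixes V :: "nat set" and E :: "nat set set" and s a b c d r :: nat
    and I J :: "nat set" and EF EH :: "nat set set" and f h :: "(nat set \<Rightarrow> bool) \<Rightarrow> bool"
  assumes F: "subnet s a I EF f" and H: "subnet s b J EH h"
    and IJ: "I \<inter> J = {}" and dist: "distinct [s, a, b, c, d, r]"
    and fresh: "{s, a, b, c, d, r} \<inter> (I \<union> J) = {}"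
    and V: "V = {s, a, b, c, d, r} \<union> I \<union> J"
    and E: "E = EF \<union> EH \<union> {{a, c}, {a, d}, {b, c}, {b, d}, {c, r}, {d, r}}"
begin

text \<open>This and the exchange of \<open>a\<close> and \<open>b\<close> below are the symmetries
  that transfer each result on one \<open>lost\<close> outcome to the three others.\<close>

lemma swap_cd: "gadget V E s a b d c r I J EF EH f h"
proof (rule gadget.intro[OF F H IJ])
  show "{s, a, b, d, c, r} \<inter> (I \<union> J) = {}" using fresh by (simp add: insert_commute)
qed (use dist in \<open>auto simp: V E\<close>)

lemma swap_ab: "gadget V E s b a c d r J I EH EF h f"
proof (rule gadget.intro[OF H F])
  show "{s, b, a, c, d, r} \<inter> (J \<union> I) = {}" using fresh by (simp add: insert_commute Un_commute)
qed (use dist IJ in \<open>auto simp: V E\<close>)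

lemma EF_D: "{x, y} \<in> EF \<Longrightarrow> x \<noteq> y \<and> {x, y} \<subseteq> insert s (insert a I) \<and> {x, y} \<inter> I \<noteq> {}"
  by (rule subnet_edges[OF F])

lemma EH_D: "{x, y} \<in> EH \<Longrightarrow> x \<noteq> y \<and> {x, y} \<subseteq> insert s (insert b J) \<and> {x, y} \<inter> J \<noteq> {}"
  by (rule subnet_edges[OF H])

lemma notin [simp]:
  "s \<notin> I" "a \<notin> I" "b \<notin> I" "c \<notin> I" "d \<notin> I" "r \<notin> I" "s \<notin> J" "a \<notin> J" "b \<notin> J" "c \<notin> J" "d \<notin> J" "r \<notin> J"
  using fresh by simp_all

lemma neq [simp]:
  "s \<noteq> a" "s \<noteq> b" "s \<noteq> c" "s \<noteq> d" "s \<noteq> r" "a \<noteq> b" "a \<noteq> c" "a \<noteq> d" "a \<noteq> r" "b \<noteq> c" "b \<noteq> d" "b \<noteq> r" "c \<noteq> d" "c \<noteq> r" "d \<noteq> r"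
  using dist by simp_all

lemmas neq_sym [simp] = neq[symmetric]

lemma fresh': "x \<in> I \<Longrightarrow> x \<notin> J \<and> x \<noteq> s \<and> x \<noteq> a \<and> x \<noteq> b \<and> x \<noteq> c \<and> x \<noteq> d \<and> x \<noteq> r"
  "x \<in> J \<Longrightarrow> x \<notin> I \<and> x \<noteq> s \<and> x \<noteq> a \<and> x \<noteq> b \<and> x \<noteq> c \<and> x \<noteq> d \<and> x \<noteq> r"
  using IJ by (auto simp: disjoint_iff)

lemma finite_V: "finite V"
  using subnet_finite(1)[OF F] subnet_finite(1)[OF H] by (simp add: V)

lemma finite_E: "finite E"
  using subnet_finite(2)[OF F] subnet_finite(2)[OF H] by (simp add: E)

lemma edge_cases:
  "e \<in> E \<Longrightarrow> e \<in> EF \<or> e \<in> EH \<or> e \<in> {{a, c}, {a, d}, {b, c}, {b, d}, {c, r}, {d, r}}"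
  by (simp only: E Un_iff disj_assoc)

lemma edge_in_V:
  assumes "{x, y} \<in> E"
  shows "x \<noteq> y \<and> x \<in> V \<and> y \<in> V"
  using edge_cases[OF assms]
proof (elim disjE)
  assume "{x, y} \<in> EF"
  from EF_D[OF this] show ?thesis by (auto simp: V)
next
  assume "{x, y} \<in> EH"
  from EH_D[OF this] show ?thesis by (auto simp: V)
next
  assume "{x, y} \<in> {{a, c}, {a, d}, {b, c}, {b, d}, {c, r}, {d, r}}"
  then show ?thesis by (auto simp: V doubleton_eq_iff)
qed

lemma network: "network V E s r"
proof -
  have "E \<subseteq> {{u, v} | u v. u \<in> V \<and> v \<in> V \<and> u \<noteq> v}"
  proof
    fix e assume e: "e \<in> E"
    have "\<exists>x y. e = {x, y}"
      using edge_cases[OF e]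
    proof (elim disjE)
      assume "e \<in> EF"
      with F obtain x y where "e = {x, y}" by (rule subnet_edgeE)
      then show ?thesis by blast
    next
      assume "e \<in> EH"
      with H obtain x y where "e = {x, y}" by (rule subnet_edgeE)
      then show ?thesis by blast
    next
      assume "e \<in> {{a, c}, {a, d}, {b, c}, {b, d}, {c, r}, {d, r}}"
      then show ?thesis by (simp only: insert_iff empty_iff) blast
    qed
    then obtain x y where xy: "e = {x, y}" by blast
    then show "e \<in> {{u, v} | u v. u \<in> V \<and> v \<in> V \<and> u \<noteq> v}"
      using edge_in_V[of x y] e by blast
  qed
  moreover have "s \<in> V" "r \<in> V" by (simp_all add: V)
  ultimately show ?thesis by (simp add: network_def finite_V)
qed

lemma finite_instructions: "finite (instructions E)"
proof (rule finite_subset)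
  show "instructions E \<subseteq> V \<times> V \<times> V"
    unfolding instructions_def by (auto dest: edge_in_V)
qed (simp add: finite_V)

text \<open>The sides of \<open>a\<close>, \<open>b\<close>, \<open>c\<close>, \<open>d\<close> can
  be prescribed. A subnetwork with both terminals on the near side is kept whole (hence
  \<open>UNIV\<close>); one with separated terminals is closed by the hypotheses and has a cut of
  its own. So only the six outer edges can be open exits.\<close>

lemma cut_set:
  assumes "f \<omega> \<Longrightarrow> ra" "h \<omega> \<Longrightarrow> rb"
  obtains X where "s \<in> X" "a \<in> X \<longleftrightarrow> ra" "b \<in> X \<longleftrightarrow> rb" "c \<in> X \<longleftrightarrow> rc" "d \<in> X \<longleftrightarrow> rd" "r \<notin> X"
    "\<And>x y. {x, y} \<in> E \<Longrightarrow> \<omega> {x, y} \<Longrightarrow> x \<in> X \<Longrightarrow> y \<notin> X \<Longrightarrow>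
        {x, y} \<in> {{a, c}, {a, d}, {b, c}, {b, d}, {c, r}, {d, r}}"
proof -
  obtain X where X: "s \<in> X" "a \<in> X \<longleftrightarrow> ra"
    "\<And>x y. {x, y} \<in> EF \<Longrightarrow> \<omega> {x, y} \<Longrightarrow> x \<in> X \<longleftrightarrow> y \<in> X"
  proof (cases ra)
    case True
    then show ?thesis by (intro that[of UNIV]) auto
  next
    case False
    then have "\<not> f \<omega>" using assms by blast
    then show ?thesis using subnet_cut[OF F] False that by metis
  qed
  obtain Y where Y: "s \<in> Y" "b \<in> Y \<longleftrightarrow> rb"
    "\<And>x y. {x, y} \<in> EH \<Longrightarrow> \<omega> {x, y} \<Longrightarrow> x \<in> Y \<longleftrightarrow> y \<in> Y"
  proof (cases rb)
    case True
    then show ?thesis by (intro that[of UNIV]) auto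
  next
    case False
    then have "\<not> h \<omega>" using assms by blast
    then show ?thesis using subnet_cut[OF H] False that by metis
  qed
  define Z where "Z = insert s ((X \<inter> insert a I) \<union> (Y \<inter> insert b J) \<union>
      (if rc then {c} else {}) \<union> (if rd then {d} else {}))"
  have IZ: "x \<in> Z \<longleftrightarrow> x \<in> X" if "x \<in> insert s (insert a I)" for x
    using that X(1) Y(1) fresh'(1)[of x] fresh'(2)[of x] by (auto simp: Z_def)
  have JZ: "x \<in> Z \<longleftrightarrow> x \<in> Y" if "x \<in> insert s (insert b J)" for x
    using that X(1) Y(1) fresh'(1)[of x] fresh'(2)[of x] by (auto simp: Z_def)
  show ?thesis
  proof (rule that[of Z])
    show "s \<in> Z" by (simp add: Z_def)
    show "a \<in> Z \<longleftrightarrow> ra" using IZ X(2) by simp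
    show "b \<in> Z \<longleftrightarrow> rb" using JZ Y(2) by simp
    show "c \<in> Z \<longleftrightarrow> rc" "d \<in> Z \<longleftrightarrow> rd" "r \<notin> Z"
      by (simp_all add: Z_def)
    fix x y assume xy: "{x, y} \<in> E" "\<omega> {x, y}" "x \<in> Z" "y \<notin> Z"
    have "{x, y} \<notin> EF"
      using EF_D[of x y] X(3)[of x y] xy IZ[of x] IZ[of y] by blast
    moreover have "{x, y} \<notin> EH"
      using EH_D[of x y] Y(3)[of x y] xy JZ[of x] JZ[of y] by blast
    ultimately show "{x, y} \<in> {{a, c}, {a, d}, {b, c}, {b, d}, {c, r}, {d, r}}"
      using xy(1) by (simp add: E)
  qed
qed

text \<open>If \<open>r\<close> is not linked, the reached vertices form a cut without open exits,
  while a surviving walk would have to leave it.\<close>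

lemma survives_connected:
  assumes "survives V E s r A \<omega>"
  shows "terminals_linked a b c d r f h \<omega>"
proof (rule ccontr)
  assume nconn: "\<not> terminals_linked a b c d r f h \<omega>"
  let ?ra = "linked a b c d f h \<omega>" and ?rb = "linked b a c d h f \<omega>"
  let ?rc = "?ra \<and> \<omega> {a, c} \<or> ?rb \<and> \<omega> {b, c}" and ?rd = "?ra \<and> \<omega> {a, d} \<or> ?rb \<and> \<omega> {b, d}"
  have ab: "f \<omega> \<Longrightarrow> ?ra" "h \<omega> \<Longrightarrow> ?rb" by (auto simp: linked_def)
  obtain X where X: "s \<in> X" "a \<in> X \<longleftrightarrow> ?ra" "b \<in> X \<longleftrightarrow> ?rb" "c \<in> X \<longleftrightarrow> ?rc" "d \<in> X \<longleftrightarrow> ?rd" "r \<notin> X"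
    "\<And>x y. {x, y} \<in> E \<Longrightarrow> \<omega> {x, y} \<Longrightarrow> x \<in> X \<Longrightarrow> y \<notin> X \<Longrightarrow>
        {x, y} \<in> {{a, c}, {a, d}, {b, c}, {b, d}, {c, r}, {d, r}}"
    by (rule cut_set[where \<omega> = \<omega> and ra = ?ra and rb = ?rb and rc = ?rc and rd = ?rd]) (use ab in blast)+
  obtain xs where xs: "xs \<in> walks V E s r" "\<forall>e \<in> walk_edges xs. \<omega> e"
    using assms by (auto simp: survives_def protocol_walks_def)
  obtain P x y Q where xy: "xs = P @ [x, y] @ Q" "x \<in> X" "y \<notin> X" "{x, y} \<in> E \<and> \<omega> {x, y}"
    by (rule leaves_set[OF successively_alive[OF xs], of X]) (use X xs in \<open>auto simp: walks_def\<close>)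
  \<comment> \<open>The reached set is closed although \<open>linked\<close> allows a single detour:
    a second detour would only lead back to a vertex that its own subnetwork reaches.\<close>
  have closed: "?rc \<and> \<omega> {a, c} \<Longrightarrow> ?ra" "?rd \<and> \<omega> {a, d} \<Longrightarrow> ?ra"
    "?rc \<and> \<omega> {b, c} \<Longrightarrow> ?rb" "?rd \<and> \<omega> {b, d} \<Longrightarrow> ?rb" "\<not> (?rc \<and> \<omega> {c, r})" "\<not> (?rd \<and> \<omega> {d, r})"
    using nconn by (auto simp: linked_def terminals_linked_def)
  have "{x, y} \<in> {{a, c}, {a, d}, {b, c}, {b, d}, {c, r}, {d, r}}"
    by (rule X(7)) (use xy in simp_all)
  moreover have "{x, y} \<noteq> {u, v}" if "u \<in> X \<longleftrightarrow> v \<in> X" for u v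
    using that xy(2,3) by (auto simp: doubleton_eq_iff)
  moreover have "u \<in> X \<longleftrightarrow> v \<in> X" if "{x, y} = {u, v}" "\<omega> {u, v} \<Longrightarrow> u \<in> X \<longleftrightarrow> v \<in> X" for u v
    using that xy(4) by simp
  ultimately show False
    using X(2-6) closed by (smt (verit) insertE singletonD)
qed

text \<open>Two cuts with a single open exit each force the two arcs; the second cut is applied to
  the part of the walk after the first exit, which gives the order.\<close>

lemma uses_before_if_lost:
  assumes "lost a b c d r f h \<omega>" "xs \<in> walks V E s r" "\<forall>e \<in> walk_edges xs. \<omega> e"
  shows "uses_before (a, c) (b, d) xs"
proof -
  let ?R = "\<lambda>x y. {x, y} \<in> E \<and> \<omega> {x, y}"
  note lost = assms(1)[unfolded lost_def]
  have alive: "successively ?R xs" by (rule successively_alive[OF assms(2,3)])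
  have ends: "xs \<noteq> []" "hd xs = s" "last xs = r" using assms(2) by (auto simp: walks_def)
  \<comment> \<open>Only \<open>s\<close> and \<open>a\<close> among the named vertices are on the
    near side. As \<open>h\<close> fails and \<open>ad\<close> is closed, the only open exit is from
    \<open>a\<close> to \<open>c\<close>.\<close>
  obtain X where X: "s \<in> X" "a \<in> X \<longleftrightarrow> True" "b \<in> X \<longleftrightarrow> False" "c \<in> X \<longleftrightarrow> False" "d \<in> X \<longleftrightarrow> False" "r \<notin> X"
    "\<And>x y. {x, y} \<in> E \<Longrightarrow> \<omega> {x, y} \<Longrightarrow> x \<in> X \<Longrightarrow> y \<notin> X \<Longrightarrow>
        {x, y} \<in> {{a, c}, {a, d}, {b, c}, {b, d}, {c, r}, {d, r}}"
    by (rule cut_set[where \<omega> = \<omega> and ra = True and rb = False and rc = False and rd = False])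
      (use lost in blast)+
  \<comment> \<open>Now \<open>b\<close> and \<open>c\<close> are on the near side too. As
    \<open>ad\<close> and \<open>cr\<close> are closed, the only open exit is from \<open>b\<close>
    to \<open>d\<close>.\<close>
  obtain Y where Y: "s \<in> Y" "a \<in> Y \<longleftrightarrow> True" "b \<in> Y \<longleftrightarrow> True" "c \<in> Y \<longleftrightarrow> True" "d \<in> Y \<longleftrightarrow> False" "r \<notin> Y"
    "\<And>x y. {x, y} \<in> E \<Longrightarrow> \<omega> {x, y} \<Longrightarrow> x \<in> Y \<Longrightarrow> y \<notin> Y \<Longrightarrow>
        {x, y} \<in> {{a, c}, {a, d}, {b, c}, {b, d}, {c, r}, {d, r}}"
    by (rule cut_set[where \<omega> = \<omega> and ra = True and rb = True and rc = True and rd = False]) blast+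
  obtain P x y Q where xy: "xs = P @ [x, y] @ Q" "x \<in> X" "y \<notin> X" "?R x y"
    by (rule leaves_set[OF alive, of X]) (use X ends in auto)
  have x_y: "x = a \<and> y = c"
  proof -
    have "{x, y} \<in> {{a, c}, {a, d}, {b, c}, {b, d}, {c, r}, {d, r}}"
      by (rule X(7)) (use xy in simp_all)
    moreover have "{x, y} \<noteq> {a, d}" using xy(4) lost by metis
    ultimately show ?thesis using xy(2,3) X(2-6) by (auto simp: doubleton_eq_iff)
  qed
  have rest: "successively ?R (c # Q)" "last (c # Q) = r"
    using alive ends by (auto simp: xy(1) x_y successively_append_iff)
  obtain P' x' y' Q' where xy': "c # Q = P' @ [x', y'] @ Q'" "x' \<in> Y" "y' \<notin> Y" "?R x' y'"
    by (rule leaves_set[OF rest(1), of Y]) (use Y rest(2) in \<open>simp_all del: last.simps\<close>)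
  have x_y': "x' = b \<and> y' = d"
  proof -
    have "{x', y'} \<in> {{a, c}, {a, d}, {b, c}, {b, d}, {c, r}, {d, r}}"
      by (rule Y(7)) (use xy' in simp_all)
    moreover have "{x', y'} \<noteq> {a, d}" "{x', y'} \<noteq> {c, r}" using xy'(4) lost by metis+
    ultimately show ?thesis using xy'(2,3) Y(2-6) by (auto simp: doubleton_eq_iff)
  qed
  \<comment> \<open>The remainder starts at \<open>c\<close>, which is not \<open>b\<close>, so the
    two arcs do not overlap.\<close>
  obtain M where "P' = c # M"
    using xy'(1) x_y' dist by (cases P') auto
  then have "xs = P @ [a, c] @ M @ [b, d] @ Q'"
    using xy(1) xy'(1) x_y x_y' by simp
  then show ?thesis unfolding uses_before_def by auto
qed

section \<open>A finite protocol that gives up two of the four outcomes\<close>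

text \<open>Increases along \<open>s \<dots> a, x, r\<close> and \<open>s \<dots> b, x, r\<close> and \<open>s \<dots> b, x, a, y, r\<close> with
  \<open>{x, y} = {c, d}\<close>, but along no route that passes through \<open>b\<close> after \<open>a\<close>.\<close>

definition rank :: "nat \<times> nat \<Rightarrow> nat" where
  "rank = (\<lambda>(x, y). let M = Suc (max a b) in
     if y = r then M + 3 else if x = b \<and> y \<in> {c, d} then M
     else if x \<in> {c, d} \<and> y = a then M + 1
     else if x = a \<and> y \<in> {c, d} then M + 2 else y)"

definition ranked :: "(nat \<times> nat \<times> nat) set" where
  "ranked = {(x, y, z) \<in> instructions E. rank (x, y) < rank (y, z)}"

lemma finite_ranked: "finite (protocol_walks V E s r ranked)"
  by (rule finite_protocol_walks_if_ranked[OF finite_V, of _ rank]) (auto simp: ranked_def)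

text \<open>Inside the subnetworks an arc has its head as rank. Arcs from \<open>a\<close> or
  \<open>b\<close> to \<open>c\<close> or \<open>d\<close> have ranks from
  \<open>Suc (max a b)\<close> on, which provides \<open>v < rank (v, t)\<close> for
  \<open>v = a\<close> and \<open>v = b\<close>.\<close>

lemma survives_ranked_path:
  assumes xs: "xs \<noteq> []" "hd xs = s" "last xs = v"
    "successively (\<lambda>x y. x < y \<and> {x, y} \<in> EF \<union> EH \<and> \<omega> {x, y}) xs"
    and ts: "last (t # ts) = r" "v < rank (v, t)" "rising rank (v # t # ts)"
    "successively (\<lambda>x y. {x, y} \<in> E \<and> \<omega> {x, y}) (v # t # ts)" and t: "t \<in> {c, d}"
  shows "survives V E s r ranked \<omega>"
proof (rule survivesI)
  let ?R = "\<lambda>x y. {x, y} \<in> E \<and> \<omega> {x, y}"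
  show "hd (xs @ t # ts) = s" "last (xs @ t # ts) = r" using xs ts by auto
  have "successively ?R xs" by (rule successively_mono[OF xs(4)]) (auto simp: E)
  then show alive: "successively ?R (xs @ t # ts)"
    using xs(1,3) ts(4) by (simp add: successively_append_iff)
  then show "set (xs @ t # ts) \<subseteq> V"
  proof -
    have "successively ?R ys \<Longrightarrow> ys \<noteq> [] \<Longrightarrow> hd ys \<in> V \<Longrightarrow> set ys \<subseteq> V" for ys
    proof (induction ys)
      case (Cons y ys)
      then show ?case by (cases ys) (auto dest: edge_in_V)
    qed simp
    from this[OF alive] show ?thesis using xs(1,2) by (simp add: V)
  qed
  have "x < y \<and> rank (x, y) = y \<and> x \<noteq> t" if "x < y \<and> {x, y} \<in> EF \<union> EH \<and> \<omega> {x, y}" for x y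
  proof -
    have "x \<notin> {c, d, r}" "y \<notin> {c, d, r}"
      using that EF_D[of x y] EH_D[of x y] by auto
    then show ?thesis using that t by (auto simp: rank_def)
  qed
  then have "successively (\<lambda>x y. x < y \<and> rank (x, y) = y \<and> x \<noteq> t) xs"
    using xs(4) by (rule successively_mono[rotated])
  then have rising: "rising rank (xs @ t # ts)"
    using xs ts by (intro rising_append) auto
  fix i assume i: "Suc (Suc i) < length (xs @ t # ts)"
  have "?R ((xs @ t # ts) ! i) ((xs @ t # ts) ! Suc i)"
    "?R ((xs @ t # ts) ! Suc i) ((xs @ t # ts) ! Suc (Suc i))"
    using alive i by (auto simp only: successively_conv_nth)
  then show "((xs @ t # ts) ! i, (xs @ t # ts) ! Suc i, (xs @ t # ts) ! Suc (Suc i)) \<in> ranked"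
    using rising_nth[OF rising i] by (simp add: ranked_def instructions_def)
qed (use xs in simp)

text \<open>Of the eight routes through the outer edges only the two that start at \<open>a\<close>
  and return through \<open>b\<close> fail to rise. If none of the six others is open, a linking
  outcome must be one of the two excluded \<open>lost\<close> outcomes.\<close>

lemma survives_ranked:
  assumes conn: "terminals_linked a b c d r f h \<omega>"
    and "\<not> lost a b c d r f h \<omega>" "\<not> lost a b d c r f h \<omega>"
  shows "survives V E s r ranked \<omega>"
proof -
  let ?R = "\<lambda>x y. {x, y} \<in> E \<and> \<omega> {x, y}"
  have six: "{a, c} \<in> E" "{a, d} \<in> E" "{b, c} \<in> E" "{b, d} \<in> E" "{c, r} \<in> E" "{d, r} \<in> E"
    "{c, a} \<in> E" "{d, a} \<in> E" by (auto simp: E insert_commute)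
  have comm: "{c, a} = {a, c}" "{d, a} = {a, d}" by auto
  have viaF: ?thesis if "f \<omega>" "(t, ts) \<in> {(c, [r]), (d, [r])}" "successively ?R (a # t # ts)" for t ts
  proof -
    obtain xs where xs: "xs \<noteq> []" "hd xs = s" "last xs = a"
      "successively (\<lambda>x y. x < y \<and> {x, y} \<in> EF \<and> \<omega> {x, y}) xs"
      using subnet_path[OF F \<open>f \<omega>\<close>] .
    have "successively (\<lambda>x y. x < y \<and> {x, y} \<in> EF \<union> EH \<and> \<omega> {x, y}) xs"
      by (rule successively_mono[OF xs(4)]) auto
    then show ?thesis
      by (rule survives_ranked_path[OF xs(1-3), where t = t and ts = ts])
        (use that(2,3) in \<open>auto simp: rank_def\<close>)
  qed
  have viaH: ?thesis if "h \<omega>" "(t, ts) \<in> {(c, [r]), (d, [r]), (c, [a, d, r]), (d, [a, c, r])}"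
    "successively ?R (b # t # ts)" for t ts
  proof -
    obtain xs where xs: "xs \<noteq> []" "hd xs = s" "last xs = b"
      "successively (\<lambda>x y. x < y \<and> {x, y} \<in> EH \<and> \<omega> {x, y}) xs"
      using subnet_path[OF H \<open>h \<omega>\<close>] .
    have "successively (\<lambda>x y. x < y \<and> {x, y} \<in> EF \<union> EH \<and> \<omega> {x, y}) xs"
      by (rule successively_mono[OF xs(4)]) auto
    then show ?thesis
      by (rule survives_ranked_path[OF xs(1-3), where t = t and ts = ts])
        (use that(2,3) in \<open>auto simp: rank_def\<close>)
  qed
  have "f \<omega> \<and> \<omega> {a, c} \<and> \<omega> {c, r} \<or> f \<omega> \<and> \<omega> {a, d} \<and> \<omega> {d, r}
      \<or> h \<omega> \<and> \<omega> {b, c} \<and> \<omega> {c, r} \<or> h \<omega> \<and> \<omega> {b, d} \<and> \<omega> {d, r}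
      \<or> h \<omega> \<and> \<omega> {b, c} \<and> \<omega> {a, c} \<and> \<omega> {a, d} \<and> \<omega> {d, r}
      \<or> h \<omega> \<and> \<omega> {b, d} \<and> \<omega> {a, d} \<and> \<omega> {a, c} \<and> \<omega> {c, r}"
    using assms unfolding terminals_linked_def linked_def lost_def by argo
  then show ?thesis
    using viaF[of c "[r]"] viaF[of d "[r]"] viaH[of c "[r]"] viaH[of d "[r]"]
      viaH[of c "[a, d, r]"] viaH[of d "[a, c, r]"] six
    by (auto simp: comm)
qed

end

lemma edge_prob_two_excluded:
  assumes "\<And>\<omega>. S \<omega> \<Longrightarrow> C \<omega>" "\<And>\<omega>. S \<omega> \<Longrightarrow> \<not> L \<omega>" "\<And>\<omega>. S \<omega> \<Longrightarrow> \<not> L' \<omega>"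
    and "\<And>\<omega>. L \<omega> \<Longrightarrow> C \<omega>" "\<And>\<omega>. L' \<omega> \<Longrightarrow> C \<omega>" "\<And>\<omega>. L \<omega> \<Longrightarrow> \<not> L' \<omega>"
  shows "edge_prob E p S \<le> edge_prob E p C - edge_prob E p L - edge_prob E p L'"
proof -
  have "edge_prob E p S \<le> edge_prob E p (\<lambda>\<omega>. (C \<omega> \<and> \<not> L \<omega>) \<and> \<not> L' \<omega>)"
    using assms(1-3) by (intro edge_prob_mono) blast
  also have "\<dots> = edge_prob E p (\<lambda>\<omega>. C \<omega> \<and> \<not> L \<omega>) - edge_prob E p L'"
    using assms(5,6) by (intro edge_prob_diff) blast
  also have "edge_prob E p (\<lambda>\<omega>. C \<omega> \<and> \<not> L \<omega>) = edge_prob E p C - edge_prob E p L"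
    using assms(4) by (intro edge_prob_diff)
  finally show ?thesis .
qed

section \<open>The optimal value of the gadget\<close>

context gadget
begin

text \<open>The six outer edges, four open and two closed, are independent of each other and of both
  subnetworks. They are peeled off from the inside out, following the nesting of the conjunction in
  \<open>lost\<close>.\<close>

lemma edge_prob_lost:
  assumes p: "0 < p" "p < 1"
  shows "edge_prob E p (lost a b c d r f h) =
      p ^ 4 * (1 - p)\<^sup>2 * (edge_prob E p f * (1 - edge_prob E p h))"
proof -
  have disj: "EF \<inter> EH = {}"
    using IJ by (intro subnet_disjoint_edges[OF F H]) simp_all
  have new: "{x, y} \<notin> EF \<union> EH" if "x \<in> {a, b, c, d, r}" "y \<in> {a, b, c, d, r}" for x y
  proof -
    have "x \<notin> I" "x \<notin> J" "y \<notin> I" "y \<notin> J" using that by auto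
    then show ?thesis using EF_D[of x y] EH_D[of x y] by auto
  qed
  note step = edge_prob_edge_conj[OF finite_E _ _ _ _ p]
  let ?B0 = "EF \<union> EH" and ?Q0 = "\<lambda>\<omega>. f \<omega> \<and> \<not> h \<omega>"
  have "edge_prob E p ?Q0 = edge_prob E p f * edge_prob E p (\<lambda>\<omega>. \<not> h \<omega>)"
    using disj by (intro edge_prob_indep[OF finite_E, of EF EH]
      subnet_depends[OF F] depends_only_not[OF subnet_depends[OF H]]) (auto simp: E)
  then have Q0: "edge_prob E p ?Q0 = edge_prob E p f * (1 - edge_prob E p h)"
    by (simp add: edge_prob_not)
  have D0: "depends_only ?B0 ?Q0"
    by (intro depends_only_conj depends_only_not subnet_depends[OF F] subnet_depends[OF H])
  have sub: "?B0 \<subseteq> E" unfolding E by (rule Un_upper1)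
  let ?B1 = "insert {c, r} ?B0" let ?B2 = "insert {a, d} ?B1" let ?B3 = "insert {d, r} ?B2"
  let ?B4 = "insert {b, d} ?B3" let ?B5 = "insert {b, c} ?B4"
  have inE: "{c, r} \<in> E" "{a, d} \<in> E" "{d, r} \<in> E" "{b, d} \<in> E" "{b, c} \<in> E" "{a, c} \<in> E"
    by (simp_all add: E)
  have subs: "?B1 \<subseteq> E" "?B2 \<subseteq> E" "?B3 \<subseteq> E" "?B4 \<subseteq> E" "?B5 \<subseteq> E"
    by (simp_all only: insert_subset sub inE)
  have new6: "{c, r} \<notin> ?B0" "{a, d} \<notin> ?B0" "{d, r} \<notin> ?B0" "{b, d} \<notin> ?B0" "{b, c} \<notin> ?B0" "{a, c} \<notin> ?B0"
    by (rule new; simp)+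
  have news: "{a, d} \<notin> ?B1" "{d, r} \<notin> ?B2" "{b, d} \<notin> ?B3" "{b, c} \<notin> ?B4" "{a, c} \<notin> ?B5"
    using new6 by (simp_all add: doubleton_eq_iff)
  note s1 = step[OF inE(1) sub new6(1) D0]
  note s2 = step[OF inE(2) subs(1) news(1) s1(4)]
  note s3 = step[OF inE(3) subs(2) news(2) s2(4)]
  note s4 = step[OF inE(4) subs(3) news(3) s3(3)]
  note s5 = step[OF inE(5) subs(4) news(4) s4(3)]
  note s6 = step[OF inE(6) subs(5) news(5) s5(3)]
  have "edge_prob E p (lost a b c d r f h) =
      p * (p * (p * (p * ((1 - p) * ((1 - p) * (edge_prob E p f * (1 - edge_prob E p h)))))))"
    unfolding lost_def[abs_def] s6(1) s5(1) s4(1) s3(1) s2(2) s1(2) Q0 ..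
  then show ?thesis by (simp add: power2_eq_square power4_eq_xxxx)
qed

text \<open>The two outcomes force the arcs from \<open>a\<close> to \<open>c\<close> and from
  \<open>b\<close> to \<open>d\<close> in opposite orders: exchanging both \<open>a\<close>,
  \<open>b\<close> and \<open>c\<close>, \<open>d\<close> interchanges these arcs.\<close>

lemma lost_exclusive:
  assumes fin: "finite (protocol_walks V E s r A)"
  shows "(\<forall>\<omega>. survives V E s r A \<omega> \<longrightarrow> \<not> lost a b c d r f h \<omega>) \<or>
         (\<forall>\<omega>. survives V E s r A \<omega> \<longrightarrow> \<not> lost b a d c r h f \<omega>)"
proof (rule ccontr)
  interpret sw: gadget V E s b a d c r J I EH EF h f
    using gadget.swap_cd[OF swap_ab] .
  assume "\<not> ?thesis"
  then obtain \<omega> \<omega>' where "survives V E s r A \<omega>" "lost a b c d r f h \<omega>"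
    "survives V E s r A \<omega>'" "lost b a d c r h f \<omega>'" by blast
  then obtain xs ys where "xs \<in> protocol_walks V E s r A" "uses_before (a, c) (b, d) xs"
    "ys \<in> protocol_walks V E s r A" "uses_before (b, d) (a, c) ys"
    using uses_before_if_lost[of \<omega>] sw.uses_before_if_lost[of \<omega>']
    by (auto simp: survives_def protocol_walks_def)
  from uses_before_both_infinite[OF this] fin show False by simp
qed

lemma lost_connected:
  "lost a b c d r f h \<omega> \<Longrightarrow> terminals_linked a b c d r f h \<omega>"
  "lost a b d c r f h \<omega> \<Longrightarrow> terminals_linked a b c d r f h \<omega>"
  "lost b a c d r h f \<omega> \<Longrightarrow> terminals_linked a b c d r f h \<omega>"
  "lost b a d c r h f \<omega> \<Longrightarrow> terminals_linked a b c d r f h \<omega>"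
  by (auto simp: lost_def terminals_linked_def linked_def)

text \<open>A finite protocol misses one of \<open>?L1\<close>, \<open>?L2\<close> and one of
  \<open>?L3\<close>, \<open>?L4\<close>. The possible losses are \<open>2 * ?k * x\<close>,
  \<open>2 * ?k * y\<close> and \<open>?k * (x + y)\<close>, of which the last is never below both
  others. This explains the factor 2 and the minimum.\<close>

lemma rho_hat_eq:
  assumes p: "0 < p" "p < 1"
  defines "u \<equiv> edge_prob E p f" and "v \<equiv> edge_prob E p h"
  shows "rho_hat V E s r p =
    edge_prob E p (terminals_linked a b c d r f h) - 2 * p ^ 4 * (1 - p)\<^sup>2 * min (u * (1 - v)) (v * (1 - u))"
proof -
  interpret cd: gadget V E s a b d c r I J EF EH f h by (rule swap_cd)
  interpret ab: gadget V E s b a c d r J I EH EF h f by (rule swap_ab)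
  interpret abcd: gadget V E s b a d c r J I EH EF h f by (rule ab.swap_cd)
  let ?L1 = "lost a b c d r f h" and ?L2 = "lost b a d c r h f"
  let ?L3 = "lost a b d c r f h" and ?L4 = "lost b a c d r h f"
  let ?C = "terminals_linked a b c d r f h"
  let ?k = "p ^ 4 * (1 - p)\<^sup>2"
  let ?S = "{rho V E s r A p | A. A \<subseteq> instructions E \<and> finite (protocol_walks V E s r A)}"
  define x where "x = u * (1 - v)"
  define y where "y = v * (1 - u)"
  have L: "edge_prob E p ?L1 = ?k * x" "edge_prob E p ?L2 = ?k * y"
     "edge_prob E p ?L3 = ?k * x" "edge_prob E p ?L4 = ?k * y"
    unfolding u_def v_def x_def y_def
    by (rule edge_prob_lost abcd.edge_prob_lost cd.edge_prob_lost ab.edge_prob_lost; fact p)+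
  have k: "0 \<le> ?k" using p by simp
  have disj: "?L1 \<omega> \<Longrightarrow> \<not> ?L3 \<omega>" "?L1 \<omega> \<Longrightarrow> \<not> ?L4 \<omega>" "?L2 \<omega> \<Longrightarrow> \<not> ?L3 \<omega>" "?L2 \<omega> \<Longrightarrow> \<not> ?L4 \<omega>" for \<omega>
    by (auto simp: lost_def)
  have upper: "z \<le> edge_prob E p ?C - 2 * ?k * min x y" if z: "z \<in> ?S" for z
  proof -
    obtain A where A: "z = edge_prob E p (survives V E s r A)" "finite (protocol_walks V E s r A)"
      using z unfolding rho_eq_edge_prob by blast
    let ?excl = "\<lambda>L. \<forall>\<omega>. survives V E s r A \<omega> \<longrightarrow> \<not> L \<omega>"
    have bound: "z \<le> edge_prob E p ?C - edge_prob E p L - edge_prob E p L'"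
      if "?excl L" "?excl L'" "\<And>\<omega>. L \<omega> \<Longrightarrow> ?C \<omega>" "\<And>\<omega>. L' \<omega> \<Longrightarrow> ?C \<omega>" "\<And>\<omega>. L \<omega> \<Longrightarrow> \<not> L' \<omega>" for L L'
      unfolding A(1) using survives_connected that by (intro edge_prob_two_excluded) blast+
    have m: "?k * min x y \<le> ?k * x" "?k * min x y \<le> ?k * y"
      using k by (auto intro!: mult_left_mono)
    from lost_exclusive[OF A(2)] cd.lost_exclusive[OF A(2)]
    consider "?excl ?L1" "?excl ?L3" | "?excl ?L1" "?excl ?L4" | "?excl ?L2" "?excl ?L3"
      | "?excl ?L2" "?excl ?L4" by blast
    then have "z \<le> edge_prob E p ?C - ?k * min x y - ?k * min x y"
    proof cases
      case 1
      from bound[OF this lost_connected(1,2) disj(1)] show ?thesis using m unfolding L by linarith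
    next
      case 2
      from bound[OF this lost_connected(1,3) disj(2)] show ?thesis using m unfolding L by linarith
    next
      case 3
      from bound[OF this lost_connected(4,2) disj(3)] show ?thesis using m unfolding L by linarith
    next
      case 4
      from bound[OF this lost_connected(4,3) disj(4)] show ?thesis using m unfolding L by linarith
    qed
    then show ?thesis by (simp add: algebra_simps)
  qed
  have two_lost: "edge_prob E p (\<lambda>\<omega>. (?C \<omega> \<and> \<not> L \<omega>) \<and> \<not> L' \<omega>) =
      edge_prob E p ?C - edge_prob E p L - edge_prob E p L'"
    if "\<And>\<omega>. L \<omega> \<Longrightarrow> ?C \<omega>" "\<And>\<omega>. L' \<omega> \<Longrightarrow> ?C \<omega>" "\<And>\<omega>. L \<omega> \<Longrightarrow> \<not> L' \<omega>" for L L'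
    using edge_prob_diff[of L' "\<lambda>\<omega>. ?C \<omega> \<and> \<not> L \<omega>" E p] edge_prob_diff[of L ?C E p] that by auto
  have lower_x: "edge_prob E p ?C - ?k * x - ?k * x \<le> rho V E s r ranked p"
  proof -
    have "edge_prob E p ?C - ?k * x - ?k * x = edge_prob E p (\<lambda>\<omega>. (?C \<omega> \<and> \<not> ?L1 \<omega>) \<and> \<not> ?L3 \<omega>)"
      using two_lost[of ?L1 ?L3, OF lost_connected(1,2) disj(1)] unfolding L by simp
    also have "\<dots> \<le> edge_prob E p (survives V E s r ranked)"
      using survives_ranked by (intro edge_prob_mono) blast
    finally show ?thesis by (simp only: rho_eq_edge_prob)
  qed
  \<comment> \<open>The ranked protocol with \<open>a\<close> and \<open>b\<close> exchanged gives
    up \<open>?L2\<close> and \<open>?L4\<close> instead.\<close>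
  have lower_y: "edge_prob E p ?C - ?k * y - ?k * y \<le> rho V E s r ab.ranked p"
  proof -
    have sym: "terminals_linked b a c d r h f \<omega>" if "?C \<omega>" for \<omega>
      using that unfolding terminals_linked_def by blast
    have "edge_prob E p ?C - ?k * y - ?k * y = edge_prob E p (\<lambda>\<omega>. (?C \<omega> \<and> \<not> ?L2 \<omega>) \<and> \<not> ?L4 \<omega>)"
      using two_lost[of ?L2 ?L4, OF lost_connected(4,3) disj(4)] unfolding L by simp
    also have "\<dots> \<le> edge_prob E p (survives V E s r ab.ranked)"
      using ab.survives_ranked sym by (intro edge_prob_mono) blast
    finally show ?thesis by (simp only: rho_eq_edge_prob)
  qed
  have in_S: "rho V E s r ranked p \<in> ?S" "rho V E s r ab.ranked p \<in> ?S"
    using finite_ranked ab.finite_ranked by (auto simp: ranked_def ab.ranked_def)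
  have attained: "edge_prob E p ?C - 2 * ?k * min x y \<in> ?S"
  proof (cases "x \<le> y")
    case True
    then have "rho V E s r ranked p = edge_prob E p ?C - 2 * ?k * min x y"
      using lower_x upper[OF in_S(1)] by (intro antisym) (simp_all add: algebra_simps)
    then show ?thesis using in_S(1) by simp
  next
    case False
    then have "rho V E s r ab.ranked p = edge_prob E p ?C - 2 * ?k * min x y"
      using lower_y upper[OF in_S(2)] by (intro antisym) (simp_all add: algebra_simps)
    then show ?thesis using in_S(2) by simp
  qed
  have "?S = (\<lambda>A. rho V E s r A p) ` {A. A \<subseteq> instructions E \<and> finite (protocol_walks V E s r A)}"
    by auto
  then have "finite ?S" using finite_instructions by simp
  then have "Max ?S = edge_prob E p ?C - 2 * ?k * min x y"
    using upper attained by (rule Max_eqI)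
  then show ?thesis by (simp add: rho_hat_def x_def y_def mult.assoc)
qed

end

section \<open>Breakpoints of a maximum of two polynomials\<close>

lemma times_differentiable_at_cong:
  assumes "\<forall>\<^sub>F x in nhds z. f x = g x"
  shows "times_differentiable_at k f z \<longleftrightarrow> times_differentiable_at k g z"
  using assms
proof (induction k f z arbitrary: g rule: times_differentiable_at.induct)
  case (1 f z)
  then show ?case by (simp add: isCont_cong)
next
  case (2 f z)
  then show ?case by (simp add: real_differentiable_def DERIV_cong_ev[OF refl _ refl])
next
  case (3 k f z)
  \<comment> \<open>Derivatives at points near \<open>z\<close> are compared, so the agreement has
    to hold around each of these points and not just at them.\<close>
  have ev: "\<forall>\<^sub>F x in nhds z. \<forall>\<^sub>F y in nhds x. f y = g y"
    using "3.prems" by (simp add: eventually_eventually)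
  have "\<forall>\<^sub>F x in nhds z. f differentiable (at x) \<longleftrightarrow> g differentiable (at x)"
    using ev by eventually_elim (simp add: real_differentiable_def DERIV_cong_ev[OF refl _ refl])
  then have "(\<forall>\<^sub>F x in nhds z. f differentiable (at x)) \<longleftrightarrow> (\<forall>\<^sub>F x in nhds z. g differentiable (at x))"
    by (rule eventually_subst)
  moreover have "\<forall>\<^sub>F x in nhds z. deriv f x = deriv g x"
    using ev by eventually_elim (simp add: deriv_cong_ev)
  ultimately show ?case using "3.IH" by simp
qed

lemma times_differentiable_at_poly: "times_differentiable_at k (poly q) z"
proof (induction k arbitrary: q)
  case 0
  then show ?case by simp
next
  case (Suc k)
  have diff: "poly q differentiable (at x)" for x
    unfolding real_differentiable_def using poly_DERIV by blast
  have "deriv (poly q) = poly (pderiv q)" by (rule ext) (rule DERIV_imp_deriv[OF poly_DERIV])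
  with Suc show ?case using diff by (cases k) simp_all
qed

section \<open>Two polynomials glued at a point\<close>

definition glue :: "real \<Rightarrow> real poly \<Rightarrow> real poly \<Rightarrow> real \<Rightarrow> real" where
  "glue z q1 q2 x = (if x \<le> z then poly q1 x else poly q2 x)"

lemma glue_DERIV_off:
  assumes "x \<noteq> z"
  shows "(glue z q1 q2 has_real_derivative glue z (pderiv q1) (pderiv q2) x) (at x)"
proof (cases "x < z")
  case True
  then have "\<forall>\<^sub>F y in nhds x. glue z q1 q2 y = poly q1 y"
    by (auto simp: glue_def intro!: eventually_mono[OF eventually_nhds_in_open[of "{..<z}"]])
  from DERIV_cong_ev[OF refl this refl]
  have "(glue z q1 q2 has_real_derivative poly (pderiv q1) x) (at x)" using poly_DERIV by blast
  then show ?thesis using True by (simp add: glue_def[of z "pderiv q1"])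
next
  case False
  then have "\<forall>\<^sub>F y in nhds x. glue z q1 q2 y = poly q2 y"
    using assms by (auto simp: glue_def intro!: eventually_mono[OF eventually_nhds_in_open[of "{z<..}"]])
  from DERIV_cong_ev[OF refl this refl]
  have "(glue z q1 q2 has_real_derivative poly (pderiv q2) x) (at x)" using poly_DERIV by blast
  then show ?thesis using False assms by (simp add: glue_def[of z "pderiv q1"])
qed

lemma glue_within:
  assumes "poly q1 z = poly q2 z"
  shows "(glue z q1 q2 has_real_derivative D) (at z within {..z}) \<longleftrightarrow> (poly q1 has_real_derivative D) (at z within {..z})"
    and "(glue z q1 q2 has_real_derivative D) (at z within {z..}) \<longleftrightarrow> (poly q2 has_real_derivative D) (at z within {z..})"
  by (rule has_field_derivative_cong_eventually; use assms in \<open>auto simp: glue_def eventually_at_filter intro!: always_eventually\<close>)+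

text \<open>The one-sided difference quotients are those of the two polynomials, so a derivative
  must equal both of theirs.\<close>

lemma glue_DERIV_at:
  assumes "poly q1 z = poly q2 z"
  shows "(glue z q1 q2 has_real_derivative D) (at z) \<longleftrightarrow>
    D = poly (pderiv q1) z \<and> D = poly (pderiv q2) z"
proof
  assume D: "(glue z q1 q2 has_real_derivative D) (at z)"
  have "(poly q1 has_real_derivative D) (at z within {..z})"
    using glue_within(1)[OF assms] has_field_derivative_at_within[OF D, of "{..z}"] by simp
  then have l: "((\<lambda>y. (poly q1 y - poly q1 z) / (y - z)) \<longlongrightarrow> D) (at_left z)"
    unfolding has_field_derivative_iff by (rule tendsto_within_subset) auto
  have "((\<lambda>y. (poly q1 y - poly q1 z) / (y - z)) \<longlongrightarrow> poly (pderiv q1) z) (at_left z)"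
    using poly_DERIV[of q1 z] unfolding has_field_derivative_iff by (rule tendsto_within_subset) auto
  with l have 1: "D = poly (pderiv q1) z"
    using tendsto_unique trivial_limit_at_left_real by blast
  have "(poly q2 has_real_derivative D) (at z within {z..})"
    using glue_within(2)[OF assms] has_field_derivative_at_within[OF D, of "{z..}"] by simp
  then have r: "((\<lambda>y. (poly q2 y - poly q2 z) / (y - z)) \<longlongrightarrow> D) (at_right z)"
    unfolding has_field_derivative_iff by (rule tendsto_within_subset) auto
  have "((\<lambda>y. (poly q2 y - poly q2 z) / (y - z)) \<longlongrightarrow> poly (pderiv q2) z) (at_right z)"
    using poly_DERIV[of q2 z] unfolding has_field_derivative_iff by (rule tendsto_within_subset) auto
  with r have "D = poly (pderiv q2) z"
    using tendsto_unique trivial_limit_at_right_real by blast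
  with 1 show "D = poly (pderiv q1) z \<and> D = poly (pderiv q2) z" by simp
next
  assume "D = poly (pderiv q1) z \<and> D = poly (pderiv q2) z"
  then have D: "D = poly (pderiv q1) z" "D = poly (pderiv q2) z" by simp_all
  have "(glue z q1 q2 has_real_derivative D) (at z within {..z})"
    unfolding glue_within(1)[OF assms] D(1) by (rule has_field_derivative_at_within[OF poly_DERIV])
  moreover have "(glue z q1 q2 has_real_derivative D) (at z within {z..})"
    unfolding glue_within(2)[OF assms] D(2) by (rule has_field_derivative_at_within[OF poly_DERIV])
  ultimately have "(glue z q1 q2 has_real_derivative D) (at z within {..z} \<union> {z..})"
    unfolding has_field_derivative_iff by (rule Lim_Un)
  moreover have "{..z} \<union> {z..} = UNIV" by auto
  ultimately show "(glue z q1 q2 has_real_derivative D) (at z)" by simp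
qed

lemma isCont_glue:
  assumes "poly q1 z = poly q2 z"
  shows "isCont (glue z q1 q2) z"
proof -
  have "continuous_on UNIV (glue z q1 q2)"
  proof -
    have "continuous_on ({..z} \<union> {z..}) (\<lambda>x. if x \<in> {..z} then poly q1 x else poly q2 x)"
      by (rule continuous_on_cases) (use assms in \<open>auto intro!: continuous_intros\<close>)
    moreover have "{..z} \<union> {z..} = UNIV" by auto
    ultimately show ?thesis by (simp add: glue_def[abs_def])
  qed
  then show ?thesis by (simp add: continuous_on_eq_continuous_at)
qed

text \<open>With equal derivatives the difference would be constant, and its value at
  \<open>z\<close> is 0. This keeps the difference nonzero when orders are lowered by
  differentiation.\<close>

lemma pderiv_neq:
  fixes q1 q2 :: "real poly"
  assumes "q1 \<noteq> q2" "poly q1 z = poly q2 z"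
  shows "pderiv q1 \<noteq> pderiv q2"
proof
  assume "pderiv q1 = pderiv q2"
  then obtain c where c: "q1 - q2 = [:c:]" using pderiv_iszero[of "q1 - q2"] by (auto simp: pderiv_diff)
  have "c = 0" using arg_cong[OF c, of "\<lambda>q. poly q z"] assms(2) by simp
  with c assms(1) show False by simp
qed

text \<open>Differentiation glues the two derivatives and lowers the order of contact by one; at
  order one the one-sided derivatives disagree.\<close>

lemma times_differentiable_at_glue:
  assumes "q1 \<noteq> q2" "order z (q1 - q2) = Suc m"
  shows "(\<forall>k\<le>m. times_differentiable_at k (glue z q1 q2) z) \<and>
    \<not> times_differentiable_at (Suc m) (glue z q1 q2) z"
  using assms
proof (induction m arbitrary: q1 q2)
  case 0
  have root: "poly q1 z = poly q2 z"
    using 0 order_root[of "q1 - q2" z] by simp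
  have "order z (pderiv (q1 - q2)) = 0"
    using order_pderiv[of "q1 - q2" z] 0 root by simp
  moreover have "pderiv (q1 - q2) \<noteq> 0"
    using pderiv_neq[OF _ root] 0 by (simp add: pderiv_diff)
  ultimately have "poly (pderiv q1) z \<noteq> poly (pderiv q2) z"
    using order_root[of "pderiv (q1 - q2)" z] by (simp add: pderiv_diff)
  then show ?case using glue_DERIV_at[OF root] isCont_glue[OF root]
    by (simp add: real_differentiable_def)
next
  case (Suc m)
  have root: "poly q1 z = poly q2 z"
    using Suc.prems order_root[of "q1 - q2" z] by simp
  have ne: "pderiv q1 \<noteq> pderiv q2"
    using pderiv_neq[OF _ root] Suc.prems by simp
  have ord: "order z (pderiv q1 - pderiv q2) = Suc m"
    using order_pderiv[of "q1 - q2" z] Suc.prems root by (simp add: pderiv_diff)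
  have root': "poly (pderiv q1) z = poly (pderiv q2) z"
    using ne ord order_root[of "pderiv q1 - pderiv q2" z] by simp
  have D: "(glue z q1 q2 has_real_derivative glue z (pderiv q1) (pderiv q2) x) (at x)" for x
  proof (cases "x = z")
    case True
    then show ?thesis using glue_DERIV_at[OF root] root' by (simp add: glue_def[of z "pderiv q1"])
  qed (rule glue_DERIV_off)
  have diff: "glue z q1 q2 differentiable (at x)" for x
    unfolding real_differentiable_def using D by blast
  have deriv: "deriv (glue z q1 q2) = glue z (pderiv q1) (pderiv q2)"
    using D by (intro ext DERIV_imp_deriv)
  note IH = Suc.IH[OF ne ord]
  have "times_differentiable_at k (glue z q1 q2) z" if "k \<le> Suc m" for k
  proof (cases k)
    case 0
    then show ?thesis using isCont_glue[OF root] by simp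
  next
    case (Suc l)
    then show ?thesis using diff deriv IH that by (cases l) simp_all
  qed
  then show ?case using IH deriv by simp
qed

lemma breakpoint_glue:
  assumes "z \<in> {0<..<1}" "\<forall>\<^sub>F x in nhds z. f x = glue z q1 q2 x"
    and "q1 \<noteq> q2" "order z (q1 - q2) = m" "m > 0"
  shows "breakpoint_of_order f m z"
proof -
  obtain l where l: "m = Suc l" using assms(5) gr0_implies_Suc by blast
  show ?thesis
    using assms(1) times_differentiable_at_glue[OF assms(3), of z l] assms(4)
    by (auto simp: l breakpoint_of_order_def times_differentiable_at_cong[OF assms(2)])
qed

lemma no_breakpoint_poly:
  assumes "\<forall>\<^sub>F x in nhds z. f x = poly q x"
  shows "\<not> breakpoint_of_order f m z"
  by (simp add: breakpoint_of_order_def times_differentiable_at_cong[OF assms] times_differentiable_at_poly)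

section \<open>The maximum of two polynomials\<close>

lemma eventually_poly_pos:
  fixes q :: "real poly"
  assumes "0 < poly q z"
  shows "\<forall>\<^sub>F x in nhds z. 0 < poly q x"
proof -
  have "open {x. 0 < poly q x}"
    by (intro open_Collect_less continuous_intros)
  from eventually_nhds_in_open[OF this, of z] assms show ?thesis by simp
qed

text \<open>At a zero of odd order the difference changes sign, so the larger polynomial changes
  over. Which one comes first is decided by the sign at \<open>z\<close> of the cofactor
  \<open>w\<close>.\<close>

lemma max_poly_eventually_glue:
  fixes Q1 Q2 :: "real poly"
  assumes "Q1 \<noteq> Q2" "odd (order z (Q1 - Q2))"
  shows "\<exists>q1 q2. {q1, q2} = {Q1, Q2} \<and> (\<forall>\<^sub>F x in nhds z. max (poly Q1 x) (poly Q2 x) = glue z q1 q2 x)"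
proof -
  let ?m = "order z (Q1 - Q2)"
  obtain w where w: "Q1 - Q2 = [:- z, 1:] ^ ?m * w" "\<not> [:- z, 1:] dvd w"
    using order_decomp[of "Q1 - Q2" z] assms by auto
  have wz: "poly w z \<noteq> 0" using w(2) poly_eq_0_iff_dvd by blast
  have D: "poly Q1 x - poly Q2 x = (x - z) ^ ?m * poly w x" for x
    using arg_cong[OF w(1), of "\<lambda>q. poly q x"] by (simp add: poly_power)
  have neg: "(x - z) ^ ?m \<le> 0" if "x \<le> z" for x
    using that assms(2) odd_pos[OF assms(2)] by (simp add: power_le_zero_eq)
  have pos: "(x - z) ^ ?m \<ge> 0" if "x > z" for x using that by simp
  show ?thesis
  proof (cases "poly w z > 0")
    case True
    from eventually_poly_pos[OF this]
    have "\<forall>\<^sub>F x in nhds z. max (poly Q1 x) (poly Q2 x) = glue z Q2 Q1 x"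
    proof eventually_elim
      case (elim x)
      show ?case
      proof (cases "x \<le> z")
        case True
        then have "poly Q1 x - poly Q2 x \<le> 0"
          unfolding D using elim neg[of x] by (intro mult_nonpos_nonneg) auto
        then show ?thesis using True by (simp add: glue_def)
      next
        case False
        then have "poly Q1 x - poly Q2 x \<ge> 0"
          unfolding D using elim pos[of x] by (intro mult_nonneg_nonneg) auto
        then show ?thesis using False by (simp add: glue_def)
      qed
    qed
    then show ?thesis by (intro exI[of _ Q2] exI[of _ Q1]) auto
  next
    case False
    then have "0 < poly (- w) z" using wz by simp
    from eventually_poly_pos[OF this]
    have "\<forall>\<^sub>F x in nhds z. max (poly Q1 x) (poly Q2 x) = glue z Q1 Q2 x"
    proof eventually_elim
      case (elim x)
      show ?case
      proof (cases "x \<le> z")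
        case True
        then have "poly Q1 x - poly Q2 x \<ge> 0"
          unfolding D using elim neg[of x] by (intro mult_nonpos_nonpos) auto
        then show ?thesis using True by (simp add: glue_def)
      next
        case False
        then have "poly Q1 x - poly Q2 x \<le> 0"
          unfolding D using elim pos[of x] by (intro mult_nonneg_nonpos) auto
        then show ?thesis using False by (simp add: glue_def)
      qed
    qed
    then show ?thesis by (intro exI[of _ Q1] exI[of _ Q2]) auto
  qed
qed

lemma max_poly_eventually_poly:
  fixes Q1 Q2 :: "real poly"
  assumes "poly Q1 z \<noteq> poly Q2 z"
  shows "\<exists>q. \<forall>\<^sub>F x in nhds z. max (poly Q1 x) (poly Q2 x) = poly q x"
proof (cases "poly Q1 z < poly Q2 z")
  case True
  then have "\<forall>\<^sub>F x in nhds z. 0 < poly (Q2 - Q1) x" by (intro eventually_poly_pos) simp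
  then have "\<forall>\<^sub>F x in nhds z. max (poly Q1 x) (poly Q2 x) = poly Q2 x" by eventually_elim simp
  then show ?thesis by blast
next
  case False
  then have "\<forall>\<^sub>F x in nhds z. 0 < poly (Q1 - Q2) x" using assms by (intro eventually_poly_pos) simp
  then have "\<forall>\<^sub>F x in nhds z. max (poly Q1 x) (poly Q2 x) = poly Q1 x" by eventually_elim simp
  then show ?thesis by blast
qed

text \<open>If neither polynomial were the maximum throughout \<open>S\<close>, their difference
  would take both signs on \<open>S\<close> and so vanish strictly between \<open>a\<close> and
  \<open>b\<close>.\<close>

lemma max_poly_piece:
  fixes Q1 Q2 :: "real poly"
  assumes "\<And>y. a < y \<Longrightarrow> y < b \<Longrightarrow> poly Q1 y \<noteq> poly Q2 y"
    and "\<And>y. y \<in> S \<Longrightarrow> a \<le> y \<and> y \<le> b"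
  shows "\<exists>q. \<forall>y\<in>S. max (poly Q1 y) (poly Q2 y) = poly q y"
proof (rule ccontr)
  assume no: "\<not> ?thesis"
  then have "\<exists>u\<in>S. poly (Q1 - Q2) u > 0" by (metis (no_types, lifting) diff_gt_0_iff_gt max.absorb2 not_le poly_diff)
  then obtain u where u: "u \<in> S" "poly (Q1 - Q2) u > 0" by blast
  have "\<exists>v\<in>S. poly (Q1 - Q2) v < 0" using no by (metis (no_types, lifting) diff_less_0_iff_less max.absorb1 not_le poly_diff)
  then obtain v where v: "v \<in> S" "poly (Q1 - Q2) v < 0" by blast
  have "u \<noteq> v" using u v by auto
  then consider "u < v" | "v < u" by linarith
  then obtain y where "min u v < y" "y < max u v" "poly (Q1 - Q2) y = 0"
    using poly_IVT_neg[of u v "Q1 - Q2"] poly_IVT_pos[of v u "Q1 - Q2"] u v by cases auto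
  moreover have "a \<le> min u v" "max u v \<le> b" using assms(2) u v by auto
  ultimately show False using assms(1)[of y] by auto
qed

lemma breakpoints_max_poly:
  fixes Q1 Q2 :: "real poly" and f :: "real \<Rightarrow> real" and x :: "nat \<Rightarrow> real"
  assumes f: "\<And>p. 0 < p \<Longrightarrow> p < 1 \<Longrightarrow> f p = max (poly Q1 p) (poly Q2 p)"
    and ne: "Q1 \<noteq> Q2"
    and x: "strict_mono_on {1..t} x" "\<And>i. i \<in> {1..t} \<Longrightarrow> x i \<in> {0<..<1}"
    and ord: "\<And>i. i \<in> {1..t} \<Longrightarrow> order (x i) (Q1 - Q2) = m i"
    and m: "\<And>i. i \<in> {1..t} \<Longrightarrow> m i > 0 \<and> odd (m i)"
    and roots: "\<And>z. z \<in> {0<..<1} \<Longrightarrow> z \<notin> x ` {1..t} \<Longrightarrow> poly Q1 z \<noteq> poly Q2 z"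
  shows "piecewise_polynomial_on 0 1 f" "breakpoints f = x ` {1..t}"
    "\<And>i. i \<in> {1..t} \<Longrightarrow> breakpoint_of_order f (m i) (x i)"
proof -
  have near: "\<forall>\<^sub>F y in nhds z. f y = max (poly Q1 y) (poly Q2 y)" if "z \<in> {0<..<1}" for z
    using that f by (intro eventually_mono[OF eventually_nhds_in_open[of "{0<..<1}"]]) auto
  show bp: "breakpoint_of_order f (m i) (x i)" if i: "i \<in> {1..t}" for i
  proof -
    obtain q1 q2 where q: "{q1, q2} = {Q1, Q2}"
      "\<forall>\<^sub>F y in nhds (x i). max (poly Q1 y) (poly Q2 y) = glue (x i) q1 q2 y"
      using max_poly_eventually_glue[OF ne, of "x i"] ord[OF i] m[OF i] by auto
    have "q1 \<noteq> q2 \<and> order (x i) (q1 - q2) = m i"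
      using q(1) ne ord[OF i] order_uminus[of "x i" "Q1 - Q2"] by (auto simp: doubleton_eq_iff)
    moreover have "\<forall>\<^sub>F y in nhds (x i). f y = glue (x i) q1 q2 y"
      using near[OF x(2)[OF i]] q(2) by eventually_elim simp
    ultimately show ?thesis using x(2)[OF i] m[OF i] by (intro breakpoint_glue) auto
  qed
  have "z \<in> x ` {1..t}" if b: "breakpoint_of_order f k z" for k z
  proof (rule ccontr)
    assume z: "z \<notin> x ` {1..t}"
    have z01: "z \<in> {0<..<1}" using b by (simp add: breakpoint_of_order_def)
    obtain q where "\<forall>\<^sub>F y in nhds z. max (poly Q1 y) (poly Q2 y) = poly q y"
      using max_poly_eventually_poly[OF roots[OF z01 z]] by blast
    with near[OF z01] have "\<forall>\<^sub>F y in nhds z. f y = poly q y" by eventually_elim simp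
    from no_breakpoint_poly[OF this] b show False by blast
  qed
  then show "breakpoints f = x ` {1..t}"
    using bp unfolding breakpoints_def by blast
  \<comment> \<open>The breakpoints framed by 0 and 1 cut the interval into \<open>Suc t\<close>
    pieces; for \<open>t = 0\<close> there is one piece.\<close>
  define c where "c i = (if i = 0 then 0 else if i = Suc t then 1 else x i)" for i
  have mono: "x i < x j" if "1 \<le> i" "i < j" "j \<le> t" for i j
    using that by (intro strict_mono_onD[OF x(1)]) auto
  have "\<exists>q. \<forall>y \<in> {c i..c (Suc i)} \<inter> {0<..<1}. f y = poly q y" if "i < Suc t" for i
  proof -
    have "poly Q1 y \<noteq> poly Q2 y" if y: "c i < y" "y < c (Suc i)" for y
    proof (rule roots)
      have "0 \<le> c i" using x(2)[of i] \<open>i < Suc t\<close> by (auto simp: c_def)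
      moreover have "c (Suc i) \<le> 1" using x(2)[of "Suc i"] \<open>i < Suc t\<close> by (auto simp: c_def)
      ultimately show "y \<in> {0<..<1}" using y by auto
      show "y \<notin> x ` {1..t}"
      proof
        assume "y \<in> x ` {1..t}"
        then obtain j where j: "1 \<le> j" "j \<le> t" "y = x j" by auto
        show False
        proof (cases "j \<le> i")
          case True
          then have "x j \<le> x i" "c i = x i"
            using mono[of j i] j \<open>i < Suc t\<close> by (cases "j = i"; force simp: c_def)+
          then show False using y j by simp
        next
          case False
          then have "x (Suc i) \<le> x j" "c (Suc i) = x (Suc i)"
            using mono[of "Suc i" j] j by (cases "j = Suc i"; force simp: c_def)+
          then show False using y j by simp
        qed
      qed
    qed
    from max_poly_piece[of "c i" "c (Suc i)" Q1 Q2 "{c i..c (Suc i)} \<inter> {0<..<1}", OF this]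
    show ?thesis using f by auto
  qed
  then obtain q where "\<And>i. i < Suc t \<Longrightarrow> \<forall>y \<in> {c i..c (Suc i)} \<inter> {0<..<1}. f y = poly (q i) y"
    by metis
  moreover have "c i < c (Suc i)" if "i < Suc t" for i
    using that x(2)[of i] x(2)[of "Suc i"] mono[of i "Suc i"] by (auto simp: c_def)
  ultimately show "piecewise_polynomial_on 0 1 f"
    unfolding piecewise_polynomial_on_def
    by (intro exI[of _ "Suc t"] exI[of _ c] exI[of _ q]) (auto simp: c_def)
qed

section \<open>Reliability differences with prescribed zeros\<close>

definition realizable_difference :: "real poly \<Rightarrow> bool" where
  "realizable_difference D \<longleftrightarrow> (\<exists>f g. realizable f \<and> realizable g \<and> D = f - g)"

text \<open>The product terms of the two parallel connections agree and cancel.\<close>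

lemma realizable_difference_mult:
  assumes "realizable_difference D" "realizable_difference D'"
  shows "realizable_difference (D * D')"
proof -
  obtain f g f' g' where *: "realizable f" "realizable g" "D = f - g"
    "realizable f'" "realizable g'" "D' = f' - g'"
    using assms unfolding realizable_difference_def by blast
  have "realizable (f * f' + g * g' - (f * f') * (g * g'))"
    "realizable (f * g' + g * f' - (f * g') * (g * f'))"
    using * by (intro realizable_parallel realizable_series; simp)+
  moreover have "D * D' = (f * f' + g * g' - (f * f') * (g * g')) - (f * g' + g * f' - (f * g') * (g * f'))"
    unfolding * by algebra
  ultimately show ?thesis unfolding realizable_difference_def by blast
qed

lemma realizable_difference_power:
  "realizable_difference D \<Longrightarrow> 0 < k \<Longrightarrow> realizable_difference (D ^ k)"
proof (induction k)
  case (Suc k)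
  then show ?case by (cases k) (auto intro: realizable_difference_mult)
qed simp

section \<open>Differences with a single simple zero\<close>

text \<open>The positive root of \<open>x\<^sup>2 + x - 1\<close>.\<close>

definition inv_golden :: real where "inv_golden = (sqrt 5 - 1) / 2"

lemma inv_golden: "0 < inv_golden" "inv_golden < 1" "inv_golden\<^sup>2 = 1 - inv_golden"
proof -
  have "1 < sqrt 5" by simp
  moreover have "sqrt 5 < 3" by (rule real_less_lsqrt) simp_all
  ultimately show "0 < inv_golden" "inv_golden < 1" by (simp_all add: inv_golden_def)
  show "inv_golden\<^sup>2 = 1 - inv_golden" by (simp add: inv_golden_def power_divide power2_diff field_simps)
qed

text \<open>As a polynomial in \<open>x = p^(2 (j + 1))\<close> this is \<open>x (1 - x) (x\<^sup>2 + x - 1)\<close>.\<close>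

definition golden_difference :: "nat \<Rightarrow> real poly" where
  "golden_difference j = (let x = monom 1 2 ^ Suc j in (x * x + x * x - (x * x) * (x * x)) - x)"

lemma realizable_golden_difference: "realizable_difference (golden_difference j)"
proof -
  have "realizable (monom 1 2 ^ Suc j)" by (intro realizable_power realizable_square)
  then show ?thesis
    unfolding realizable_difference_def golden_difference_def Let_def
    by (blast intro: realizable_parallel realizable_series)
qed

text \<open>The zero of \<open>golden_difference j\<close> in (0,1). Roots of a number below 1 grow
  with the index, so different \<open>j\<close> give different zeros, already in increasing
  order.\<close>

definition golden_root :: "nat \<Rightarrow> real" where
  "golden_root j = root (2 * Suc j) inv_golden"

lemma golden_root: "0 < golden_root j" "golden_root j < 1" "golden_root j ^ (2 * Suc j) = inv_golden"
  using inv_golden by (auto simp: golden_root_def real_root_lt_1_iff simp del: mult_Suc_right)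

lemma golden_root_mono: "i < j \<Longrightarrow> golden_root i < golden_root j"
  unfolding golden_root_def using inv_golden by (intro real_root_strict_increasing) auto

text \<open>The second root of \<open>x\<^sup>2 + x - 1\<close> is the negative number
  \<open>- (1 + inv_golden)\<close>, so \<open>?u\<close> has no zero in (0,1). The zero of
  \<open>?w\<close> is simple, as the derivative of a positive power vanishes at no positive
  point.\<close>

lemma golden_difference_neq_0: "golden_difference j \<noteq> 0"
  and order_golden_difference:
    "0 < z \<Longrightarrow> z < 1 \<Longrightarrow> order z (golden_difference j) = (if z = golden_root j then 1 else 0)"
proof -
  define N where "N = 2 * Suc j"
  define x :: "real poly" where "x = monom 1 N"
  let ?u = "x * (1 - x) * (x + [:1 + inv_golden:])" and ?w = "x - [:inv_golden:]"
  have N: "0 < N" by (simp add: N_def)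
  have px: "poly x y = y ^ N" for y by (simp add: x_def poly_monom)
  have eq: "golden_difference j = ?u * ?w"
  proof (rule poly_ext)
    fix y
    have x_alt: "monom 1 2 ^ Suc j = x" by (simp only: x_def N_def monom_power power_one)
    let ?X = "poly x y"
    have "?X * ?X + ?X * ?X - ?X * ?X * (?X * ?X) - ?X =
        ?X * (1 - ?X) * (?X + (1 + inv_golden)) * (?X - inv_golden)"
      using inv_golden(3) by algebra
    then show "poly (golden_difference j) y = poly (?u * ?w) y"
      by (simp only: golden_difference_def Let_def x_alt poly_diff poly_add poly_mult poly_1 poly_pCons
          poly_0 mult_zero_right add_0_right)
  qed
  have u: "poly ?u z \<noteq> 0" if "0 < z" "z < 1" for z
  proof -
    have "0 < z ^ N" "z ^ N < 1" using that N by (simp_all add: power_less_one_iff)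
    then have "z ^ N \<noteq> 0" "1 - z ^ N \<noteq> 0" "z ^ N + (1 + inv_golden) \<noteq> 0"
      using inv_golden(1) by linarith+
    then show ?thesis by (simp add: px)
  qed
  have w0: "poly ?w z = 0 \<longleftrightarrow> z = golden_root j" if "0 < z" for z
  proof -
    have "z = golden_root j" if "z ^ N = golden_root j ^ N"
      using that \<open>0 < z\<close> golden_root(1)[of j] N by (metis less_imp_le power_eq_imp_eq_base)
    then show ?thesis using golden_root(3)[of j] by (auto simp: px N_def)
  qed
  \<comment> \<open>A sample point in (0,1) away from the zero, which shows that the polynomial is
    not 0.\<close>
  have "0 < golden_root j / 2" "golden_root j / 2 < 1" "golden_root j / 2 \<noteq> golden_root j"
    using golden_root(1,2)[of j] by auto
  from u[OF this(1,2)] w0[OF this(1)] this(3) have "poly (golden_difference j) (golden_root j / 2) \<noteq> 0"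
    unfolding eq by simp
  then show ne: "golden_difference j \<noteq> 0" by auto
  have wne: "?w \<noteq> 0" using ne eq by auto
  assume z: "0 < z" "z < 1"
  have "order z ?w = (if z = golden_root j then 1 else 0)"
  proof (cases "z = golden_root j")
    case True
    have "pderiv ?w = monom (of_nat N) (N - 1)"
      by (simp add: x_def pderiv_diff pderiv_monom pderiv_pCons)
    then have "poly (pderiv ?w) z \<noteq> 0" using z N by (simp add: poly_monom)
    then have "order z (pderiv ?w) = 0" by (rule order_0I)
    then show ?thesis using order_pderiv[OF wne] w0[OF z(1)] True by simp
  next
    case False
    then show ?thesis using w0[OF z(1)] by (simp add: order_0I)
  qed
  moreover have "order z ?u = 0" using u[OF z] by (rule order_0I)
  ultimately show "order z (golden_difference j) = (if z = golden_root j then 1 else 0)"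
    using ne unfolding eq by (subst order_mult) auto
qed

lemma order_power: "p \<noteq> 0 \<Longrightarrow> order z (p ^ k) = k * order z p" for p :: "'a::idom poly"
  by (induction k) (auto simp: order_mult)

lemma order_prod:
  fixes g :: "'b \<Rightarrow> 'a::idom poly"
  assumes "finite A" "\<And>i. i \<in> A \<Longrightarrow> g i \<noteq> 0"
  shows "order z (\<Prod>i\<in>A. g i) = (\<Sum>i\<in>A. order z (g i))"
  using assms by (induction A rule: finite_induct) (auto simp: order_mult)

lemma realizable_difference_with_roots:
  fixes m :: "nat \<Rightarrow> nat"
  assumes m: "\<And>i. i \<in> {1..t} \<Longrightarrow> m i > 0"
  obtains f g where "realizable f" "realizable g" "f \<noteq> g"
    "\<And>i. i \<in> {1..t} \<Longrightarrow> order (golden_root i) (f - g) = m i"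
    "\<And>z. z \<in> {0<..<1} \<Longrightarrow> z \<notin> golden_root ` {1..t} \<Longrightarrow> order z (f - g) = 0"
proof -
  \<comment> \<open>All realizable polynomials vanish at 0, so the empty product 1 is not a
    realizable difference. \<open>B\<close> starts the induction instead; it has no zero in (0,1)
    and settles the case \<open>t = 0\<close>.\<close>
  define B :: "real poly" where "B = monom 1 2 - monom 1 2 * monom 1 2"
  define D where "D = B * (\<Prod>i\<in>{1..t}. golden_difference i ^ m i)"
  have B: "realizable_difference B"
    unfolding realizable_difference_def B_def using realizable_square realizable_series by blast
  have "realizable_difference (B * (\<Prod>i\<in>A. golden_difference i ^ m i))"
    if "finite A" "A \<subseteq> {1..t}" for A
    using that
  proof (induction A rule: finite_induct)
    case empty
    then show ?case using B by simp
  next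
    case (insert i A)
    then have "realizable_difference (golden_difference i ^ m i)"
      using m by (intro realizable_difference_power realizable_golden_difference) auto
    from realizable_difference_mult[OF this insert.IH] insert show ?case
      by (simp add: mult.left_commute)
  qed
  then have "realizable_difference D" by (simp add: D_def)
  then obtain f g where fg: "realizable f" "realizable g" "D = f - g"
    unfolding realizable_difference_def by blast
  have Bz: "poly B z \<noteq> 0" if "z \<in> {0<..<1}" for z
  proof -
    have "z\<^sup>2 < 1" using that by (simp add: power_less_one_iff)
    then have "z\<^sup>2 * (1 - z\<^sup>2) \<noteq> 0" using that by simp
    moreover have "poly B z = z\<^sup>2 * (1 - z\<^sup>2)" by (simp add: B_def poly_monom algebra_simps)
    ultimately show ?thesis by simp
  qed
  have "B \<noteq> 0" using Bz[of "1/2"] by auto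
  then have "D \<noteq> 0" by (simp add: D_def golden_difference_neq_0)
  have ord: "order z D = (\<Sum>i\<in>{1..t}. if z = golden_root i then m i else 0)" if z: "z \<in> {0<..<1}" for z
  proof -
    have "order z D = order z B + order z (\<Prod>i\<in>{1..t}. golden_difference i ^ m i)"
      using \<open>D \<noteq> 0\<close> unfolding D_def by (rule order_mult)
    also have "order z B = 0" using Bz[OF z] by (rule order_0I)
    also have "order z (\<Prod>i\<in>{1..t}. golden_difference i ^ m i) =
        (\<Sum>i\<in>{1..t}. order z (golden_difference i ^ m i))"
      by (rule order_prod) (simp_all add: golden_difference_neq_0)
    also have "\<dots> = (\<Sum>i\<in>{1..t}. if z = golden_root i then m i else 0)"
      using z by (intro sum.cong)
        (auto simp: order_power[OF golden_difference_neq_0] order_golden_difference)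
    finally show ?thesis by simp
  qed
  have inj: "golden_root i = golden_root j \<longleftrightarrow> i = j" for i j
    using golden_root_mono[of i j] golden_root_mono[of j i] by (cases i j rule: linorder_cases) auto
  show ?thesis
  proof (rule that[OF fg(1,2)])
    show "f \<noteq> g" using \<open>D \<noteq> 0\<close> fg(3) by auto
    show "order (golden_root i) (f - g) = m i" if "i \<in> {1..t}" for i
      unfolding fg(3)[symmetric] using ord[of "golden_root i"] golden_root(1,2)[of i] that
      by (simp add: inj)
    show "order z (f - g) = 0" if "z \<in> {0<..<1}" "z \<notin> golden_root ` {1..t}" for z
      unfolding fg(3)[symmetric] using ord[OF that(1)] that(2) by (auto intro!: sum.neutral)
  qed
qed

section \<open>Assembling the graph\<close>

lemma rho_hat_realizes_max:
  assumes "realizable f" "realizable g"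
  obtains V :: "nat set" and E s r C where "network V E s r"
    "\<And>p. 0 < p \<Longrightarrow> p < 1 \<Longrightarrow> rho_hat V E s r p = poly C p -
      2 * p ^ 4 * (1 - p)\<^sup>2 * min (poly f p * (1 - poly g p)) (poly g p * (1 - poly f p))"
proof -
  obtain k where k: "\<And>u v n. u < n \<and> n + k \<le> v \<Longrightarrow>
     (\<exists>E P. subnet u v {n..<n + k} E P \<and>
        (\<forall>E' p. finite E' \<and> E \<subseteq> E' \<and> 0 < p \<and> p < 1 \<longrightarrow> edge_prob E' p P = poly f p))"
    using assms(1) unfolding realizable_def by blast
  obtain l where l: "\<And>u v n. u < n \<and> n + l \<le> v \<Longrightarrow>
     (\<exists>E P. subnet u v {n..<n + l} E P \<and>
        (\<forall>E' p. finite E' \<and> E \<subseteq> E' \<and> 0 < p \<and> p < 1 \<longrightarrow> edge_prob E' p P = poly g p))"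
    using assms(2) unfolding realizable_def by blast
  \<comment> \<open>The sender is 0, followed by the inner block of \<open>f\<close> and that of
    \<open>g\<close>. Both \<open>a\<close> and \<open>b\<close> lie above the two blocks, as
    increasing paths require.\<close>
  define a where "a = 1 + k + l"
  define b c d r where "b = a + 1" "c = a + 2" "d = a + 3" "r = a + 4"
  obtain EF P where EF: "subnet 0 a {1..<1 + k} EF P"
    "\<And>E' p. finite E' \<and> EF \<subseteq> E' \<and> 0 < p \<and> p < 1 \<Longrightarrow> edge_prob E' p P = poly f p"
    using k[of 0 1 a] by (auto simp: a_def)
  obtain EH Q where EH: "subnet 0 b {1 + k..<1 + k + l} EH Q"
    "\<And>E' p. finite E' \<and> EH \<subseteq> E' \<and> 0 < p \<and> p < 1 \<Longrightarrow> edge_prob E' p Q = poly g p"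
    using l[of 0 "1 + k" b] by (auto simp: a_def b_c_d_r_def)
  let ?V = "{0, a, b, c, d, r} \<union> {1..<1 + k} \<union> {1 + k..<1 + k + l}"
  let ?E = "EF \<union> EH \<union> {{a, c}, {a, d}, {b, c}, {b, d}, {c, r}, {d, r}}"
  interpret gadget ?V ?E 0 a b c d r "{1..<1 + k}" "{1 + k..<1 + k + l}" EF EH P Q
    by (rule gadget.intro[OF EF(1) EH(1)]) (auto simp: a_def b_c_d_r_def)
  obtain C where C: "\<And>p. 0 \<le> p \<Longrightarrow> p \<le> 1 \<Longrightarrow>
      edge_prob ?E p (terminals_linked a b c d r P Q) = poly C p"
    using edge_prob_polynomial[OF finite_E] by blast
  show ?thesis
  proof (rule that[OF network])
    fix p :: real assume p: "0 < p" "p < 1"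
    have "edge_prob ?E p P = poly f p" "edge_prob ?E p Q = poly g p"
      using p finite_E by (auto intro!: EF(2) EH(2))
    then show "rho_hat ?V ?E 0 r p = poly C p -
      2 * p ^ 4 * (1 - p)\<^sup>2 * min (poly f p * (1 - poly g p)) (poly g p * (1 - poly f p))"
      using rho_hat_eq[OF p] C[of p] p by simp
  qed
qed

theorem theorem7p1:
  fixes t :: nat and m :: "nat \<Rightarrow> nat"
  assumes "\<And>i. i \<in> {1..t} \<Longrightarrow> m i > 0 \<and> odd (m i)"
  shows "\<exists>(V :: nat set) E s r. network V E s r \<and>
           piecewise_polynomial_on 0 1 (rho_hat V E s r) \<and>
           (\<exists>x :: nat \<Rightarrow> real.
              strict_mono_on {1..t} x \<and>
              breakpoints (rho_hat V E s r) = x ` {1..t} \<and>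
              (\<forall>i\<in>{1..t}. breakpoint_of_order (rho_hat V E s r) (m i) (x i)))"
proof -
  obtain f g where fg: "realizable f" "realizable g" "f \<noteq> g"
    "\<And>i. i \<in> {1..t} \<Longrightarrow> order (golden_root i) (f - g) = m i"
    "\<And>z. z \<in> {0<..<1} \<Longrightarrow> z \<notin> golden_root ` {1..t} \<Longrightarrow> order z (f - g) = 0"
    using realizable_difference_with_roots[of t m] assms by blast
  obtain V :: "nat set" and E s r C where net: "network V E s r"
    and rho: "\<And>p. 0 < p \<Longrightarrow> p < 1 \<Longrightarrow> rho_hat V E s r p = poly C p -
      2 * p ^ 4 * (1 - p)\<^sup>2 * min (poly f p * (1 - poly g p)) (poly g p * (1 - poly f p))"
    using rho_hat_realizes_max[OF fg(1,2)] by blast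
  define K :: "real poly" where "K = smult 2 (monom 1 4 * [:1, -1:]\<^sup>2)"
  define Q1 where "Q1 = C - K * (f * (1 - g))"
  define Q2 where "Q2 = C - K * (g * (1 - f))"
  have K: "poly K p = 2 * p ^ 4 * (1 - p)\<^sup>2" for p
    by (simp add: K_def poly_monom poly_power)
  have K0: "poly K p > 0" if "0 < p" "p < 1" for p
    unfolding K using that by simp
  have "K \<noteq> 0" using K0[of "1/2"] by auto
  have diff: "Q1 - Q2 = K * - (f - g)" unfolding Q1_def Q2_def by algebra
  have ne: "K * - (f - g) \<noteq> 0" using \<open>K \<noteq> 0\<close> fg(3) by simp
  have ord: "order z (Q1 - Q2) = order z (f - g)" if "0 < z" "z < 1" for z
  proof -
    have "order z K = 0" using K0[OF that] by (intro order_0I) simp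
    then show ?thesis using order_mult[OF ne, of z] unfolding diff order_uminus by simp
  qed
  have rho_max: "rho_hat V E s r p = max (poly Q1 p) (poly Q2 p)" if "0 < p" "p < 1" for p
  proof -
    \<comment> \<open>\<open>K\<close> is positive on (0,1), so it moves inside the minimum;
      subtraction from \<open>C\<close> then turns the minimum into a maximum.\<close>
    have "poly K p * min (poly f p * (1 - poly g p)) (poly g p * (1 - poly f p)) =
        min (poly K p * (poly f p * (1 - poly g p))) (poly K p * (poly g p * (1 - poly f p)))"
      using K0[OF that] by (simp add: min_mult_distrib_left)
    then show ?thesis unfolding rho[OF that] K[symmetric] Q1_def Q2_def by simp
  qed
  have Q12: "Q1 \<noteq> Q2" using ne diff by auto
  have mono: "strict_mono_on {1..t} golden_root"
    by (intro strict_mono_onI golden_root_mono)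
  have root01: "golden_root i \<in> {0<..<1}" for i using golden_root(1,2)[of i] by simp
  have ord_root: "order (golden_root i) (Q1 - Q2) = m i" if "i \<in> {1..t}" for i
    using ord[of "golden_root i"] fg(4)[OF that] golden_root(1,2)[of i] by simp
  have no_root: "poly Q1 z \<noteq> poly Q2 z" if "z \<in> {0<..<1}" "z \<notin> golden_root ` {1..t}" for z
    using ord[of z] fg(5)[OF that] that(1) Q12 order_root[of "Q1 - Q2" z] by auto
  note * = breakpoints_max_poly[where f = "rho_hat V E s r", OF rho_max Q12 mono root01 ord_root assms no_root]
  show ?thesis
    using net mono * by blast
qed

end
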